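(* Let $\mathcal{Z}$ be an imprecise continuous-time hidden Markov chain, built from an ICTMC $\mathbb{P}_{\mathcal{Q},\mathcal{M}}$ and an output model $(\mathcal{Y},\Sigma,P_{\mathcal{Y}|\mathcal{X}})$, and consider any $u,v\in\mathcal{U}$, $y_u\in\mathcal{Y}_u$ and $f\in\mathcal{L}(\mathcal{X}_v)$. Let $\{O_u^i\}_{i\in\mathbb{N}}$ be any sequence in $\Sigma_u$ that shrinks to $y_u$. If for some sequence $\{\lambda_i\}_{i\in\mathbb{N}}$ in $\mathbb{R}_{>0}$ the limit $$\phi_u(y_u\mid x_u)=\lim_{i\to+\infty}\frac{P_{\mathcal{Y}|\mathcal{X}}(O_u^i\mid x_u)}{\lambda_i}$$ exists and is real-valued for every $x_u\in\mathcal{X}_u$, and $\underline{\mathbb{E}}_{\mathcal{Q},\mathcal{M}}[\phi_u(y_u\mid X_u)]>0$, then the updated lower expectation $\underline{\mathbb{E}}_{\mathcal{Z}}[f(X_v)\mid Y_u=y_u]=\inf\{\mathbb{E}_P[f(X_v)\mid Y_u=y_u]:P\in\mathcal{Z}\}$ satisfies $$\underline{\mathbb{E}}_{\mathcal{Z}}[f(X_v)\mid Y_u=y_u]=\max\bigl\{\mu\in\mathbb{R}:\ \underline{\mathbb{E}}_{\mathcal{Q},\mathcal{M}}\bigl[\phi_u(y_u\mid X_u)\bigl(f(X_v)-\mu\bigr)\bigr]\ge 0\bigr\}.$$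
   Context: $\mathcal{X}$ is a fixed non-empty finite set (the state space). $\mathcal{U}$ is the set of all non-empty finite sets $u\subset\mathbb{R}_{\ge 0}$ (viewed as increasingly ordered sequences of time points). For $u\in\mathcal{U}$, $\mathcal{X}_u=\prod_{t\in u}\mathcal{X}$ with generic element $x_u=(x_t)_{t\in u}$, and $\mathcal{L}(\mathcal{X}_u)$ is the set of real-valued functions on $\mathcal{X}_u$. The sets $u,v$ may overlap; a product such as $g(X_u)f(X_v)$ is a function of $X_{u\cup v}$. Stochastic processes. Let $\Omega$ be the set of all functions $\omega:\mathbb{R}_{\ge 0}\to\mathcal{X}$ and $X_t(\omega)=\omega(t)$. A continuous-time stochastic process $P_{\mathcal{X}}$ assigns a number $P_{\mathcal{X}}(A\mid X_u=x_u)$ to every finite, possibly empty, $u\subset\mathbb{R}_{\ge0}$, every $x_u\in\mathcal{X}_u$ and every $A$ in the algebra generated by the events $(X_s=x)$, $x\in\mathcal{X}$, with $s\in u$ or $s$ larger than all elements of $u$, in such a way that it extends to a full conditional probability on $\Omega$, i.e. a map $(A,C)\mapsto P(A\mid C)$ defined for all $A\subseteq\Omega$ and $\emptyset\ne C\subseteq\Omega$ with: $P(A\mid C)\ge 0$; $P(A\mid C)=1$ if $C\subseteq A$; $P(A\cup B\mid C)=P(A\mid C)+P(B\mid C)$ if $A\cap B=\emptyset$; $P(A\cap D\mid C)=P(A\mid D\cap C)P(D\mid C)$ if $D\cap C\neq\emptyset$. For $u=\emptyset$ one writes $P_{\mathcal{X}}(A)$, and $\mathbb{E}_{P_{\mathcal{X}}}[h(X_w)]=\sum_{x_w\in\mathcal{X}_w}h(x_w)P_{\mathcal{X}}(X_w=x_w)$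 for $w\in\mathcal{U}$, $h\in\mathcal{L}(\mathcal{X}_w)$. ICTMC. A rate matrix is a real $|\mathcal{X}|\times|\mathcal{X}|$ matrix with non-negative off-diagonal entries and rows summing to zero. Standing assumptions: $\mathcal{M}$ is a non-empty set of probability mass functions on $\mathcal{X}$; $\mathcal{Q}$ is a non-empty, convex set of rate matrices that is bounded (there is $c\ge 0$ with $|Q(x,x)|<c$ for all $Q\in\mathcal{Q}$, $x\in\mathcal{X}$) and has separately specified rows (every rate matrix $Q$, such that for each $x$ there is $Q'\in\mathcal{Q}$ with $Q(x,\cdot)=Q'(x,\cdot)$, belongs to $\mathcal{Q}$). For a process $P_{\mathcal{X}}$, times $t\le s$, and a (possibly empty) finite history $x_u$ with all elements of $u$ smaller than $t$, let $T_{t,x_u}^s(x,y)=P_{\mathcal{X}}(X_s=y\mid X_t=x,X_u=x_u)$. $P_{\mathcal{X}}$ is well-behaved if for all such $t,x_u$ the matrices $\frac1\Delta(T_{t,x_u}^{t+\Delta}-I)$ and (for $t>0$) $\frac1\Delta(T_{t-\Delta,x_u}^{t}-I)$ remain bounded as $\Delta\to0^+$; it is consistent with $\mathcal{Q}$ if all limit points of these matrices as $\Delta\to0^+$ belong to $\mathcal{Q}$. The imprecise continuous-time Markov chain (ICTMC) $\mathbb{P}_{\mathcal{Q},\mathcal{M}}$ is the set of all well-behaved processes consistent with $\mathcal{Q}$ whose initial mass function $P_{\mathcal{X}}(X_0=\cdot)$ belongs to $\mathcal{M}$. Define $\underline{\mathbb{E}}_{\mathcal{Q},\mathcal{M}}[\cdot]=\inf\{\mathbb{E}_{P_{\mathcal{X}}}[\cdot]:P_{\mathcal{X}}\in\mathbb{P}_{\mathcal{Q},\mathcal{M}}\}$.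 Output model. A tuple $(\mathcal{Y},\Sigma,P_{\mathcal{Y}|\mathcal{X}})$ with $\mathcal{Y}$ a set, $\Sigma$ an algebra on $\mathcal{Y}$ and, for each $x\in\mathcal{X}$, $P_{\mathcal{Y}|\mathcal{X}}(\cdot\mid x)$ a finitely additive probability measure on $(\mathcal{Y},\Sigma)$. $\mathcal{Y}_u=\prod_{t\in u}\mathcal{Y}$; $\Sigma_u$ is the set of products $O_u=\times_{t\in u}O_t$ with all $O_t\in\Sigma$, and $P_{\mathcal{Y}|\mathcal{X}}(O_u\mid x_u)=\prod_{t\in u}P_{\mathcal{Y}|\mathcal{X}}(O_t\mid x_t)$. A sequence $\{O_u^i\}_{i\in\mathbb{N}}$ in $\Sigma_u$ shrinks to $y_u$ if $O_u^i\supseteq O_u^{i+1}$ for all $i$ and $\bigcap_i O_u^i=\{y_u\}$. Augmented process. $P=P_{\mathcal{Y}|\mathcal{X}}\otimes P_{\mathcal{X}}$ has joint probabilities $P(Y_u\in O_u,X_u=x_u,X_w=x_w)=P_{\mathcal{Y}|\mathcal{X}}(O_u\mid x_u)P_{\mathcal{X}}(X_u=x_u,X_w=x_w)$ for $u\cap w=\emptyset$, other probabilities being obtained by marginalisation. The imprecise continuous-time hidden Markov chain (ICTHMC) is $\mathcal{Z}=\{P_{\mathcal{Y}|\mathcal{X}}\otimes P_{\mathcal{X}}:P_{\mathcal{X}}\in\mathbb{P}_{\mathcal{Q},\mathcal{M}}\}$. For $P\in\mathcal{Z}$ with $P(Y_u\in O_u)>0$, $\mathbb{E}_P[f(X_v)\mid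 Y_u\in O_u]=\sum_{x_v\in\mathcal{X}_v}f(x_v)\frac{P(X_v=x_v,Y_u\in O_u)}{P(Y_u\in O_u)}$. Relative to the chosen sequence $\{O_u^i\}$ shrinking to $y_u$, $\mathbb{E}_P[f(X_v)\mid Y_u=y_u]=\lim_{i\to+\infty}\mathbb{E}_P[f(X_v)\mid Y_u\in O_u^i]$. *)

theory Defs
  imports "HOL-Probability.Probability_Mass_Function"
begin

text \<open>
  The finite non-empty state space is a type \<open>'x::finite\<close>. Tuples indexed by a finite set \<open>u\<close> of time
  points are extensional functions on \<open>u\<close>; in particular \<open>\<lambda>_. undefined\<close> is the unique empty tuple.
\<close>

definition time_sets :: "real set set" where
  "time_sets = {u. finite u \<and> u \<noteq> {} \<and> u \<subseteq> {0..}}"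

definition states :: "real set \<Rightarrow> (real \<Rightarrow> 'x) set" where
  "states u = (u \<rightarrow>\<^sub>E UNIV)"

definition paths :: "(real \<Rightarrow> 'x) set" where
  "paths = ({0..} \<rightarrow>\<^sub>E UNIV)"

definition state_event :: "real set \<Rightarrow> (real \<Rightarrow> 'x) \<Rightarrow> (real \<Rightarrow> 'x) set" where
  "state_event u x = {\<omega> \<in> paths. \<forall>t\<in>u. \<omega> t = x t}"


section \<open>Stochastic processes\<close>

definition full_conditional_probability ::
  "'w set \<Rightarrow> ('w set \<Rightarrow> 'w set \<Rightarrow> real) \<Rightarrow> bool" where
  "full_conditional_probability \<Omega> P \<longleftrightarrow>
     (\<forall>C. C \<subseteq> \<Omega> \<and> C \<noteq> {} \<longrightarrow>
        (\<forall>A. A \<subseteq> \<Omega> \<longrightarrow> 0 \<le> P A C) \<and>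
        (\<forall>A. C \<subseteq> A \<and> A \<subseteq> \<Omega> \<longrightarrow> P A C = 1) \<and>
        (\<forall>A B. A \<subseteq> \<Omega> \<and> B \<subseteq> \<Omega> \<and> A \<inter> B = {} \<longrightarrow> P (A \<union> B) C = P A C + P B C) \<and>
        (\<forall>A D. A \<subseteq> \<Omega> \<and> D \<subseteq> \<Omega> \<and> D \<inter> C \<noteq> {} \<longrightarrow> P (A \<inter> D) C = P A (D \<inter> C) * P D C))"

definition event_algebra :: "real set \<Rightarrow> (real \<Rightarrow> 'x) set set" where
  "event_algebra u =
     algebra paths hull {{\<omega> \<in> paths. \<omega> s = x} | s x. 0 \<le> s \<and> (s \<in> u \<or> (\<forall>r\<in>u. r < s))}"

text \<open>
  \<open>P A u x\<close> is the probability of \<open>A\<close> conditional on \<open>X\<^sub>u = x\<close>. Processes are total functions here,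
  but only their values for finite \<open>u \<subseteq> {0..}\<close>, \<open>x \<in> states u\<close> and \<open>A \<in> event_algebra u\<close> have a
  meaning; they are the only ones that are constrained, and the only ones that affect what follows.
\<close>

type_synonym 'x process = "(real \<Rightarrow> 'x) set \<Rightarrow> real set \<Rightarrow> (real \<Rightarrow> 'x) \<Rightarrow> real"

definition stochastic_process :: "'x process \<Rightarrow> bool" where
  "stochastic_process P \<longleftrightarrow>
     (\<exists>P'. full_conditional_probability paths P' \<and>
       (\<forall>u x A. finite u \<and> u \<subseteq> {0..} \<and> x \<in> states u \<and> A \<in> event_algebra u \<longrightarrow>
          P A u x = P' A (state_event u x)))"

definition uncond :: "'x process \<Rightarrow> (real \<Rightarrow> 'x) set \<Rightarrow> real" where
  "uncond P A = P A {} (\<lambda>_. undefined)"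

definition expect :: "'x process \<Rightarrow> real set \<Rightarrow> ((real \<Rightarrow> 'x) \<Rightarrow> real) \<Rightarrow> real" where
  "expect P w h = (\<Sum>x\<in>states w. h x * uncond P (state_event w x))"


section \<open>Imprecise continuous-time Markov chains\<close>

definition rate_matrix :: "real^'x^'x \<Rightarrow> bool" where
  "rate_matrix Q \<longleftrightarrow> (\<forall>x y. x \<noteq> y \<longrightarrow> 0 \<le> Q $ x $ y) \<and> (\<forall>x. (\<Sum>y\<in>UNIV. Q $ x $ y) = 0)"

definition bounded_rates :: "(real^'x^'x) set \<Rightarrow> bool" where
  "bounded_rates \<Q> \<longleftrightarrow> (\<exists>c\<ge>0. \<forall>Q\<in>\<Q>. \<forall>x. \<bar>Q $ x $ x\<bar> < c)"

definition separately_specified_rows :: "(real^'x^'x) set \<Rightarrow> bool" where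
  "separately_specified_rows \<Q> \<longleftrightarrow>
     (\<forall>Q. rate_matrix Q \<and> (\<forall>x. \<exists>Q'\<in>\<Q>. Q $ x = Q' $ x) \<longrightarrow> Q \<in> \<Q>)"

definition transition_matrix ::
  "'x::finite process \<Rightarrow> real set \<Rightarrow> (real \<Rightarrow> 'x) \<Rightarrow> real \<Rightarrow> real \<Rightarrow> real^'x^'x" where
  "transition_matrix P u xu t s =
     (\<chi> x y. P {\<omega> \<in> paths. \<omega> s = y} (insert t u) (xu(t := x)))"

definition right_quotient ::
  "'x::finite process \<Rightarrow> real set \<Rightarrow> (real \<Rightarrow> 'x) \<Rightarrow> real \<Rightarrow> real \<Rightarrow> real^'x^'x" where
  "right_quotient P u xu t \<Delta> = (1 / \<Delta>) *\<^sub>R (transition_matrix P u xu t (t + \<Delta>) - mat 1)"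

definition left_quotient ::
  "'x::finite process \<Rightarrow> real set \<Rightarrow> (real \<Rightarrow> 'x) \<Rightarrow> real \<Rightarrow> real \<Rightarrow> real^'x^'x" where
  "left_quotient P u xu t \<Delta> = (1 / \<Delta>) *\<^sub>R (transition_matrix P u xu (t - \<Delta>) t - mat 1)"

definition history :: "real \<Rightarrow> real set \<Rightarrow> (real \<Rightarrow> 'x) \<Rightarrow> bool" where
  "history t u xu \<longleftrightarrow> finite u \<and> u \<subseteq> {0..} \<and> (\<forall>r\<in>u. r < t) \<and> xu \<in> states u"

definition well_behaved :: "'x::finite process \<Rightarrow> bool" where
  "well_behaved P \<longleftrightarrow>
     (\<forall>t\<ge>0. \<forall>u xu. history t u xu \<longrightarrow>
        Bfun (right_quotient P u xu t) (at_right 0) \<and>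
        (0 < t \<longrightarrow> Bfun (left_quotient P u xu t) (at_right 0)))"

definition limit_points_at_0 :: "(real \<Rightarrow> 'a::topological_space) \<Rightarrow> 'a set" where
  "limit_points_at_0 F =
     {L. \<exists>\<delta>::nat \<Rightarrow> real. (\<forall>n. 0 < \<delta> n) \<and> \<delta> \<longlonglongrightarrow> 0 \<and> (\<lambda>n. F (\<delta> n)) \<longlonglongrightarrow> L}"

definition consistent_with :: "(real^'x^'x) set \<Rightarrow> 'x::finite process \<Rightarrow> bool" where
  "consistent_with \<Q> P \<longleftrightarrow>
     (\<forall>t\<ge>0. \<forall>u xu. history t u xu \<longrightarrow>
        limit_points_at_0 (right_quotient P u xu t) \<subseteq> \<Q> \<and>
        (0 < t \<longrightarrow> limit_points_at_0 (left_quotient P u xu t) \<subseteq> \<Q>))"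

definition ictmc :: "(real^'x^'x) set \<Rightarrow> 'x::finite pmf set \<Rightarrow> 'x process set" where
  "ictmc \<Q> \<M> =
     {P. stochastic_process P \<and> well_behaved P \<and> consistent_with \<Q> P \<and>
         (\<exists>p\<in>\<M>. \<forall>x. uncond P {\<omega> \<in> paths. \<omega> 0 = x} = pmf p x)}"

text \<open>
  The infimum is taken in the reals. It is a genuine one: the expectations are bounded below by
  \<open>Min (h ` states w)\<close>, and an ICTMC with non-empty parameter sets \<open>\<Q>\<close> and \<open>\<M>\<close> is non-empty, as it
  contains homogeneous Markov chains.
\<close>

definition lower_expect ::
  "(real^'x^'x) set \<Rightarrow> 'x::finite pmf set \<Rightarrow> real set \<Rightarrow> ((real \<Rightarrow> 'x) \<Rightarrow> real) \<Rightarrow> real" where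
  "lower_expect \<Q> \<M> w h = (INF P\<in>ictmc \<Q> \<M>. expect P w h)"


section \<open>Output models\<close>

definition output_model :: "'y set \<Rightarrow> 'y set set \<Rightarrow> ('x \<Rightarrow> 'y set \<Rightarrow> real) \<Rightarrow> bool" where
  "output_model Y \<S> K \<longleftrightarrow>
     algebra Y \<S> \<and>
     (\<forall>x. (\<forall>A\<in>\<S>. 0 \<le> K x A) \<and> K x Y = 1 \<and> Measure_Space.additive \<S> (K x))"

text \<open>
  A product event is given by the family \<open>B\<close> of its factors and denotes the set \<open>Pi\<^sub>E u B\<close>. The
  factors of a non-empty product are determined by it, and an empty product has an empty factor, so
  \<open>output_prob\<close> depends only on the product set.
\<close>

definition output_prob ::
  "('x \<Rightarrow> 'y set \<Rightarrow> real) \<Rightarrow> real set \<Rightarrow> (real \<Rightarrow> 'y set) \<Rightarrow> (real \<Rightarrow> 'x) \<Rightarrow> real" where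
  "output_prob K u B x = (\<Prod>t\<in>u. K (x t) (B t))"

definition shrinks_to ::
  "real set \<Rightarrow> (nat \<Rightarrow> real \<Rightarrow> 'y set) \<Rightarrow> (real \<Rightarrow> 'y) \<Rightarrow> bool" where
  "shrinks_to u B y \<longleftrightarrow>
     (\<forall>i. Pi\<^sub>E u (B (Suc i)) \<subseteq> Pi\<^sub>E u (B i)) \<and> (\<Inter>i. Pi\<^sub>E u (B i)) = {y}"


section \<open>Imprecise continuous-time hidden Markov chains\<close>

text \<open>
  An augmented process is represented by its joint probabilities: \<open>R u B xu w xw\<close> is the probability
  of \<open>Y\<^sub>u \<in> B\<close>, \<open>X\<^sub>u = xu\<close>, \<open>X\<^sub>w = xw\<close> for disjoint \<open>u\<close> and \<open>w\<close>.
\<close>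

type_synonym ('x, 'y) augmented =
  "real set \<Rightarrow> (real \<Rightarrow> 'y set) \<Rightarrow> (real \<Rightarrow> 'x) \<Rightarrow> real set \<Rightarrow> (real \<Rightarrow> 'x) \<Rightarrow> real"

definition augment ::
  "('x \<Rightarrow> 'y set \<Rightarrow> real) \<Rightarrow> 'x process \<Rightarrow> ('x, 'y) augmented" where
  "augment K P =
     (\<lambda>u B xu w xw. output_prob K u B xu * uncond P (state_event u xu \<inter> state_event w xw))"

definition icthmc ::
  "('x \<Rightarrow> 'y set \<Rightarrow> real) \<Rightarrow> (real^'x^'x) set \<Rightarrow> 'x::finite pmf set \<Rightarrow> ('x, 'y) augmented set" where
  "icthmc K \<Q> \<M> = augment K ` ictmc \<Q> \<M>"

definition prob_Y :: "('x, 'y) augmented \<Rightarrow> real set \<Rightarrow> (real \<Rightarrow> 'y set) \<Rightarrow> real" where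
  "prob_Y R u B = (\<Sum>xu\<in>states u. R u B xu {} (\<lambda>_. undefined))"

text \<open>
  The probability of \<open>X\<^sub>v = xv\<close>, \<open>Y\<^sub>u \<in> B\<close>, where \<open>u\<close> and \<open>v\<close> may overlap: marginalise over the states
  at the times in \<open>u - v\<close>.
\<close>

definition prob_XY ::
  "('x, 'y) augmented \<Rightarrow> real set \<Rightarrow> (real \<Rightarrow> 'x) \<Rightarrow> real set \<Rightarrow> (real \<Rightarrow> 'y set) \<Rightarrow> real" where
  "prob_XY R v xv u B =
     (\<Sum>xu\<in>{xu \<in> states u. \<forall>t\<in>u \<inter> v. xu t = xv t}. R u B xu (v - u) (restrict xv (v - u)))"

definition cond_expect ::
  "('x, 'y) augmented \<Rightarrow> real set \<Rightarrow> ((real \<Rightarrow> 'x) \<Rightarrow> real) \<Rightarrow> real set \<Rightarrow> (real \<Rightarrow> 'y set) \<Rightarrow> real" where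
  "cond_expect R v f u B = (\<Sum>xv\<in>states v. f xv * (prob_XY R v xv u B / prob_Y R u B))"

definition updated_expect ::
  "('x, 'y) augmented \<Rightarrow> real set \<Rightarrow> ((real \<Rightarrow> 'x) \<Rightarrow> real) \<Rightarrow>
     real set \<Rightarrow> (nat \<Rightarrow> real \<Rightarrow> 'y set) \<Rightarrow> real" where
  "updated_expect R v f u B = lim (\<lambda>i. cond_expect R v f u (B i))"

definition lower_updated_expect ::
  "('x, 'y) augmented set \<Rightarrow> real set \<Rightarrow> ((real \<Rightarrow> 'x) \<Rightarrow> real) \<Rightarrow>
     real set \<Rightarrow> (nat \<Rightarrow> real \<Rightarrow> 'y set) \<Rightarrow> real" where
  "lower_updated_expect \<Z> v f u B = (INF R\<in>\<Z>. updated_expect R v f u B)"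

definition is_maximum :: "real \<Rightarrow> real set \<Rightarrow> bool" where
  "is_maximum m S \<longleftrightarrow> m \<in> S \<and> (\<forall>s\<in>S. s \<le> m)"

end

theory Submission
  imports Defs "HOL-Real_Asymp.Real_Asymp"
begin

text \<open>
  For a single process \<open>P\<close> of the chain, dividing numerator and denominator by \<open>l i\<close> shows that the
  conditional expectations converge to \<open>E\<^sub>P[\<phi> f] / E\<^sub>P[\<phi>]\<close>, where \<open>E\<^sub>P[\<phi>]\<close> is bounded away from zero
  uniformly in \<open>P\<close>. Hence \<open>\<mu>\<close> is a lower bound of all these quotients iff \<open>E\<^sub>P[\<phi> (f - \<mu>)] \<ge> 0\<close> for all
  \<open>P\<close>, and the largest lower bound is the infimum.

  The infimum is meaningful only if some process exists, that is, if the law of a homogeneous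
  Markov chain extends to a full conditional probability. For a finite grid of times and a finite
  set of paths, a finitely supported law charges all these paths and has, on the grid, the
  transition probabilities of a chain whose jump distribution is perturbed so as to be strictly
  positive. Its elementary conditional probabilities form a point of a compact product of unit
  intervals, and every cluster point along refinement of grid and path set and vanishing
  perturbation is a full conditional probability with the transition matrices \<open>exp (t Q)\<close>.
\<close>

section \<open>Limits of elementary conditional probabilities\<close>

text \<open>Each axiom involves finitely many values and holds exactly for elementary conditional
  probabilities once the conditioning events have positive mass. If every single path is eventually
  charged, so is every non-empty event in \<Omega>, and the axioms pass to a pointwise cluster
  point.\<close>

lemma full_conditional_probability_limit:
  fixes m :: "'i \<Rightarrow> 'w pmf"
  assumes F: "F \<noteq> bot"
    and charged: "\<And>\<omega>. \<omega> \<in> \<Omega> \<Longrightarrow> eventually (\<lambda>i. \<omega> \<in> set_pmf (m i)) F"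
  shows "\<exists>P. full_conditional_probability \<Omega> P \<and>
    (\<forall>A C L. ((\<lambda>i. measure (m i) (A \<inter> C) / measure (m i) C) \<longlongrightarrow> L) F \<longrightarrow> P A C = L)"
proof -
  \<comment> \<open>Where \<open>C\<close> has mass zero the quotient is 0 by convention, so every
    \<open>q i\<close> lies in the cube \<open>B\<close>, compact by Tychonoff.\<close>
  define q where "q i = (\<lambda>AC. measure (m i) (fst AC \<inter> snd AC) / measure (m i) (snd AC))" for i
  define B :: "('w set \<times> 'w set \<Rightarrow> real) set" where "B = PiE UNIV (\<lambda>_. {0..1})"
  have "compactin (product_topology (\<lambda>_. euclidean) UNIV) B"
    unfolding B_def by (subst compactin_PiE) simp
  then have cpt: "compact B"
    by (simp add: euclidean_product_topology)
  have qB: "q i \<in> B" for i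
  proof -
    have "q i AC \<in> {0..1}" for AC
      by (cases "measure (m i) (snd AC) = 0")
        (auto simp: q_def divide_simps measure_nonneg zero_less_measure_iff
          intro!: measure_pmf.finite_measure_mono)
    then show ?thesis by (auto simp: B_def)
  qed
  have "filtermap q F \<noteq> bot"
    using F by (simp add: filtermap_bot_iff)
  moreover have "eventually (\<lambda>g. g \<in> B) (filtermap q F)"
    using qB by (simp add: eventually_filtermap)
  ultimately obtain p where p: "inf (nhds p) (filtermap q F) \<noteq> bot"
    using cpt unfolding compact_filter by blast
  \<comment> \<open>\<open>G\<close> refines both \<open>nhds p\<close> and
    \<open>filtermap q F\<close>: coordinates converge along it to those of \<open>p\<close>, and
    whatever eventually holds of \<open>q i\<close> holds along it.\<close>
  define G where "G = inf (nhds p) (filtermap q F)"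
  have G: "G \<noteq> bot" using p G_def by simp
  have lim: "((\<lambda>g. g AC) \<longlongrightarrow> p AC) G" for AC
  proof -
    have "continuous_on UNIV (\<lambda>g :: 'w set \<times> 'w set \<Rightarrow> real. g AC)"
      by (rule continuous_on_product_coordinates)
    then have "((\<lambda>g. g AC) \<longlongrightarrow> p AC) (at p)"
      by (simp add: continuous_on_def)
    then have "((\<lambda>g. g AC) \<longlongrightarrow> p AC) (nhds p)"
      using tendsto_at_iff_tendsto_nhds[of "\<lambda>g. g AC" p] by blast
    then show ?thesis unfolding G_def by (rule tendsto_mono[OF inf_le1])
  qed
  have ev: "eventually R G" if "eventually (\<lambda>i. R (q i)) F" for R
    using that unfolding G_def by (metis eventually_filtermap filter_leD inf_le2)
  have pos: "eventually (\<lambda>i. measure (m i) C > 0) F" if C: "C \<subseteq> \<Omega>" "C \<noteq> {}" for C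
  proof -
    obtain \<omega> where "\<omega> \<in> C" using C by auto
    then have "eventually (\<lambda>i. \<omega> \<in> set_pmf (m i)) F" using charged C by auto
    then show ?thesis
      by eventually_elim (use \<open>\<omega> \<in> C\<close> in \<open>auto simp: measure_pmf_zero_iff zero_less_measure_iff\<close>)
  qed
  define P where "P A C = p (A, C)" for A C
  have "full_conditional_probability \<Omega> P"
    unfolding full_conditional_probability_def
  proof (intro allI impI conjI; (elim conjE)?)
    fix C A assume C: "C \<subseteq> \<Omega>" "C \<noteq> {}"
    have "eventually (\<lambda>g. g (A, C) \<ge> 0) G"
      by (rule ev) (simp add: q_def)
    then show "0 \<le> P A C"
      unfolding P_def by (rule tendsto_lowerbound[OF lim _ G])
  next
    fix C A assume C: "C \<subseteq> \<Omega>" "C \<noteq> {}" "C \<subseteq> A"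
    have "eventually (\<lambda>g. g (A, C) = 1) G"
      by (rule ev, use pos[OF C(1,2)] in eventually_elim)
        (use C in \<open>auto simp: q_def Int_absorb1\<close>)
    from tendsto_cong[THEN iffD1, OF this lim] show "P A C = 1"
      unfolding P_def by (rule tendsto_unique[OF G _ tendsto_const])
  next
    fix C A D :: "'w set" assume C: "C \<subseteq> \<Omega>" "C \<noteq> {}" and disj: "A \<inter> D = {}"
    have "(A \<union> D) \<inter> C = (A \<inter> C) \<union> (D \<inter> C)" "(A \<inter> C) \<inter> (D \<inter> C) = {}"
      using disj by auto
    then have "q i (A \<union> D, C) = q i (A, C) + q i (D, C)" for i
      by (simp add: q_def measure_pmf.finite_measure_Union add_divide_distrib)
    then have "eventually (\<lambda>g. g (A \<union> D, C) = g (A, C) + g (D, C)) G"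
      by (intro ev) simp
    from tendsto_cong[THEN iffD1, OF this lim] show "P (A \<union> D) C = P A C + P D C"
      unfolding P_def by (rule tendsto_unique[OF G _ tendsto_add[OF lim lim]])
  next
    fix C A D :: "'w set" assume C: "C \<subseteq> \<Omega>" "C \<noteq> {}" and D: "D \<inter> C \<noteq> {}"
    \<comment> \<open>Positive mass of \<open>D \<inter> C\<close> lets this common factor cancel in
      the product of the two quotients.\<close>
    have "eventually (\<lambda>i. measure (m i) (D \<inter> C) > 0) F"
      by (rule pos) (use C D in auto)
    then have "eventually (\<lambda>i. q i (A \<inter> D, C) = q i (A, D \<inter> C) * q i (D, C)) F"
      by eventually_elim (simp add: q_def Int_assoc)
    then have "eventually (\<lambda>g. g (A \<inter> D, C) = g (A, D \<inter> C) * g (D, C)) G"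
      by (rule ev)
    from tendsto_cong[THEN iffD1, OF this lim] show "P (A \<inter> D) C = P A (D \<inter> C) * P D C"
      unfolding P_def by (rule tendsto_unique[OF G _ tendsto_mult[OF lim lim]])
  qed
  moreover have "P A C = L"
    if "((\<lambda>i. measure (m i) (A \<inter> C) / measure (m i) C) \<longlongrightarrow> L) F" for A C L
  proof -
    have "((\<lambda>g. g (A, C)) \<longlongrightarrow> L) (filtermap q F)"
      using that by (simp add: filterlim_filtermap q_def)
    then have "((\<lambda>g. g (A, C)) \<longlongrightarrow> L) G"
      unfolding G_def by (rule tendsto_mono[OF inf_le2])
    then show ?thesis
      unfolding P_def by (rule tendsto_unique[OF G lim])
  qed
  ultimately show ?thesis by blast
qed

section \<open>Transition kernels of homogeneous Markov chains\<close>

lemma measure_bind_pmf_finite: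
  fixes p :: "'a::finite pmf"
  shows "measure (bind_pmf p f) S = (\<Sum>x\<in>UNIV. pmf p x * measure (f x) S)"
proof -
  have "ennreal (measure (bind_pmf p f) S) = ennreal (\<Sum>x\<in>UNIV. pmf p x * measure (f x) S)"
    by (simp add: measure_pmf.emeasure_eq_measure[symmetric])
      (subst nn_integral_measure_pmf_support[of UNIV],
        simp_all add: measure_pmf.emeasure_eq_measure ennreal_mult[symmetric] mult.commute
          sum_nonneg set_pmf_iff)
  then show ?thesis
    by (simp add: sum_nonneg)
qed

text \<open>The convolution sum is the binomial expansion of \<open>(a + b) ^ k\<close>. This
  additivity of jump counts underlies the semigroup law of \<open>jump_kernel\<close>.\<close>

lemma poisson_pmf_add:
  assumes "0 < a" "0 < b"
  shows "bind_pmf (poisson_pmf a) (\<lambda>m. map_pmf ((+) m) (poisson_pmf b)) = poisson_pmf (a + b)"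
proof (rule pmf_eqI)
  fix k
  have "pmf (map_pmf ((+) m) (poisson_pmf b)) k = (if m \<le> k then pmf (poisson_pmf b) (k - m) else 0)" for m
  proof (cases "m \<le> k")
    case True
    then have "k = m + (k - m)" by simp
    then have "pmf (map_pmf ((+) m) (poisson_pmf b)) k = pmf (poisson_pmf b) (k - m)"
      by (metis inj_on_add pmf_map_inj')
    then show ?thesis using True by simp
  next
    case False
    then have "k \<notin> (+) m ` set_pmf (poisson_pmf b)" by auto
    then show ?thesis using False by (simp add: pmf_eq_0_set_pmf)
  qed
  then have "pmf (bind_pmf (poisson_pmf a) (\<lambda>m. map_pmf ((+) m) (poisson_pmf b))) k =
      (\<integral>m. (if m \<le> k then pmf (poisson_pmf b) (k - m) else 0) \<partial>poisson_pmf a)"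
    by (simp add: pmf_bind)
  also have "\<dots> = (\<Sum>m\<le>k. pmf (poisson_pmf b) (k - m) * pmf (poisson_pmf a) m)"
    by (subst integral_measure_pmf_real[of "{..k}"]) (auto split: if_splits)
  also have "\<dots> = (\<Sum>m\<le>k. real (k choose m) * a ^ m * b ^ (k - m)) / fact k * exp (- (a + b))"
    using assms
    by (auto simp: sum_divide_distrib sum_distrib_right binomial_fact exp_add exp_diff exp_minus field_simps
        intro!: sum.cong)
  also have "\<dots> = pmf (poisson_pmf (a + b)) k"
    using assms by (simp add: binomial_ring)
  finally show "pmf (bind_pmf (poisson_pmf a) (\<lambda>m. map_pmf ((+) m) (poisson_pmf b))) k =
      pmf (poisson_pmf (a + b)) k" .
qed

primrec steps :: "('x \<Rightarrow> 'x pmf) \<Rightarrow> nat \<Rightarrow> 'x \<Rightarrow> 'x pmf" where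
  "steps A 0 x = return_pmf x"
| "steps A (Suc n) x = bind_pmf (A x) (steps A n)"

lemma steps_0 [simp]: "steps A 0 = return_pmf"
  by (rule ext) simp

lemma steps_add: "steps A (m + n) = (\<lambda>x. bind_pmf (steps A m x) (steps A n))"
  by (induction m) (auto simp: fun_eq_iff bind_return_pmf bind_assoc_pmf intro!: bind_pmf_cong)

text \<open>The transition kernel \<open>exp (t Q)\<close> for \<open>Q = r (A - I)\<close>, by uniformization.\<close>

definition jump_kernel :: "('x \<Rightarrow> 'x pmf) \<Rightarrow> real \<Rightarrow> real \<Rightarrow> 'x \<Rightarrow> 'x pmf" where
  "jump_kernel A r t x = bind_pmf (poisson_pmf (r * t)) (\<lambda>n. steps A n x)"

text \<open>Chapman-Kolmogorov: the Poisson jump counts of the two intervals add, and the steps of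
  the jump chain compose. The second count is independent of the states visited, so it can be drawn
  before them.\<close>

lemma jump_kernel_add:
  assumes "0 < r" "0 < s" "0 < t"
  shows "bind_pmf (jump_kernel A r s x) (jump_kernel A r t) = jump_kernel A r (s + t) x"
proof -
  have "jump_kernel A r (s + t) x =
      bind_pmf (poisson_pmf (r * s)) (\<lambda>m. bind_pmf (poisson_pmf (r * t)) (\<lambda>n. steps A (m + n) x))"
    using assms
    by (simp add: jump_kernel_def distrib_left poisson_pmf_add[symmetric] bind_assoc_pmf bind_map_pmf)
  also have "\<dots> = bind_pmf (jump_kernel A r s x) (jump_kernel A r t)"
    unfolding jump_kernel_def steps_add bind_assoc_pmf
    by (subst bind_commute_pmf[of "poisson_pmf (r * t)"]) simp
  finally show ?thesis by simp
qed

text \<open>A Poisson count of positive mean charges the value 1, and a single jump already reaches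
  every state.\<close>

lemma set_pmf_jump_kernel:
  assumes "0 < r" "0 < t" "\<And>x. set_pmf (A x) = UNIV"
  shows "set_pmf (jump_kernel A r t x) = UNIV"
proof -
  have "set_pmf (steps A (Suc 0) x) = UNIV"
    using assms by (simp add: bind_return_pmf')
  then show ?thesis
    using assms unfolding jump_kernel_def set_bind_pmf by (auto simp del: steps.simps)
qed

section \<open>Continuity in the jump distribution and the generator\<close>

lemma tendsto_pmf_bind_finite:
  fixes p :: "'i \<Rightarrow> 'a::finite pmf"
  assumes "\<And>x. ((\<lambda>i. pmf (p i) x) \<longlongrightarrow> pmf p' x) F"
    and "\<And>x. ((\<lambda>i. pmf (f i x) y) \<longlongrightarrow> pmf (f' x) y) F"
  shows "((\<lambda>i. pmf (bind_pmf (p i) (f i)) y) \<longlongrightarrow> pmf (bind_pmf p' f') y) F"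
  unfolding pmf.rep_eq measure_bind_pmf_finite
  by (intro tendsto_sum tendsto_mult assms[unfolded pmf.rep_eq])

text \<open>For a fixed number of jumps only finite sums occur; the random number of jumps is
  handled by dominated convergence with the constant bound 1.\<close>

lemma tendsto_pmf_jump_kernel:
  fixes A :: "nat \<Rightarrow> 'x::finite \<Rightarrow> 'x pmf"
  assumes "\<And>x y. (\<lambda>i. pmf (A i x) y) \<longlonglongrightarrow> pmf (A' x) y"
  shows "(\<lambda>i. pmf (jump_kernel (A i) r t x) y) \<longlonglongrightarrow> pmf (jump_kernel A' r t x) y"
proof -
  have "(\<lambda>i. pmf (steps (A i) n x) y) \<longlonglongrightarrow> pmf (steps A' n x) y" for n x
    by (induction n arbitrary: x) (auto intro!: tendsto_pmf_bind_finite assms)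
  then show ?thesis
    unfolding jump_kernel_def pmf_bind
    by (intro integral_dominated_convergence[where w="\<lambda>_. 1"]) (auto simp: pmf_le_1)
qed

text \<open>Splitting by the number of jumps, at most one jump gives the first-order term, and two
  or more jumps have probability \<open>o(t)\<close>.\<close>

lemma jump_kernel_right_derivative:
  assumes r: "0 < r"
  shows "((\<lambda>t. (pmf (jump_kernel A r t x) y - (if x = y then 1 else 0)) / t) \<longlongrightarrow>
    r * (pmf (A x) y - (if x = y then 1 else 0))) (at_right 0)"
proof -
  define d :: real where "d = (if x = y then 1 else 0)"
  define a where "a n = pmf (steps A n x) y" for n
  have a0: "a 0 = d" "a 1 = pmf (A x) y"
    by (auto simp: a_def d_def bind_return_pmf')
  \<comment> \<open>\<open>lo\<close> is the contribution of at most one jump, and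
    \<open>err\<close> the probability of two or more, where \<open>a n\<close> is merely estimated
    by 0 and 1.\<close>
  define lo where "lo t = exp (- (r * t)) * (d + r * t * a 1)" for t
  define err where "err t = 1 - exp (- (r * t)) * (1 + r * t)" for t
  have bound: "lo t \<le> pmf (jump_kernel A r t x) y" "pmf (jump_kernel A r t x) y \<le> lo t + err t" if t: "0 < t" for t
  proof -
    let ?p = "poisson_pmf (r * t)"
    have rt: "0 < r * t" using r t by simp
    have int: "integrable ?p g" if "\<And>n. norm (g n) \<le> 2" for g :: "nat \<Rightarrow> real"
      using that by (intro measure_pmf.integrable_const_bound[where B=2]) auto
    have lo: "(\<integral>n. (if n \<le> 1 then a n else 0) \<partial>?p) = lo t"
      using rt by (subst integral_measure_pmf_real[of "{0, 1}"])
        (auto simp: lo_def a0[symmetric] algebra_simps le_Suc_eq split: if_splits)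
    have "(\<integral>n. (if n \<le> 1 then 1 else 0 :: real) \<partial>?p) = exp (- (r * t)) * (1 + r * t)"
      using rt by (subst integral_measure_pmf_real[of "{0, 1}"])
        (auto simp: algebra_simps le_Suc_eq split: if_splits)
    moreover have "(\<integral>n. (if n \<le> 1 then 0 else 1 :: real) \<partial>?p) =
        (\<integral>n. 1 - (if n \<le> 1 then 1 else 0 :: real) \<partial>?p)"
      by (intro Bochner_Integration.integral_cong) auto
    moreover have "\<dots> = (\<integral>n. 1 \<partial>?p) - (\<integral>n. (if n \<le> 1 then 1 else 0 :: real) \<partial>?p)"
      by (intro Bochner_Integration.integral_diff int) auto
    ultimately have err: "(\<integral>n. (if n \<le> 1 then 0 else 1 :: real) \<partial>?p) = err t"
      by (simp add: err_def)
    have a01: "0 \<le> a n" "a n \<le> 1" for n by (auto simp: a_def pmf_le_1)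
    have a2: "a n \<le> 2" for n using a01(2)[of n] by simp
    have K: "pmf (jump_kernel A r t x) y = (\<integral>n. a n \<partial>?p)"
      by (simp add: jump_kernel_def pmf_bind a_def)
    show "lo t \<le> pmf (jump_kernel A r t x) y"
      unfolding K lo[symmetric]
      by (intro integral_mono int) (use a01 a2 in auto)
    have "pmf (jump_kernel A r t x) y \<le>
      (\<integral>n. (if n \<le> 1 then a n else 0) + (if n \<le> 1 then 0 else 1) \<partial>?p)"
      unfolding K
      by (intro integral_mono int) (use a01 a2 in auto)
    also have "\<dots> = lo t + err t"
      unfolding lo[symmetric] err[symmetric]
      by (intro Bochner_Integration.integral_add int) (use a01 a2 in auto)
    finally show "pmf (jump_kernel A r t x) y \<le> lo t + err t" .
  qed
  have "((\<lambda>t. (pmf (jump_kernel A r t x) y - d) / t) \<longlongrightarrow> r * (a 1 - d)) (at_right 0)"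
  proof (rule tendsto_sandwich)
    show "eventually (\<lambda>t. (lo t - d) / t \<le> (pmf (jump_kernel A r t x) y - d) / t) (at_right 0)"
      using bound by (auto simp: eventually_at_filter divide_right_mono)
    show "eventually (\<lambda>t. (pmf (jump_kernel A r t x) y - d) / t \<le> (lo t + err t - d) / t) (at_right 0)"
      using bound by (auto simp: eventually_at_filter divide_right_mono)
    have lo: "((\<lambda>t. (lo t - d) / t) \<longlongrightarrow> r * (a 1 - d)) (at_right 0)"
    proof -
      have "((\<lambda>t. (exp (- (r * t)) - 1) / t) \<longlongrightarrow> - r) (at_right 0)"
        using r by real_asymp
      moreover have "((\<lambda>t. exp (- (r * t)) * r) \<longlongrightarrow> r) (at_right 0)"
        using r by real_asymp
      ultimately have "((\<lambda>t. d * ((exp (- (r * t)) - 1) / t) + a 1 * (exp (- (r * t)) * r)) \<longlongrightarrow> d * - r + a 1 * r) (at_right 0)"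
        by (intro tendsto_intros)
      also have "d * - r + a 1 * r = r * (a 1 - d)" by (simp add: algebra_simps)
      finally show ?thesis
        by (rule Lim_transform_eventually) (auto simp: eventually_at_filter lo_def field_simps)
    qed
    show "((\<lambda>t. (lo t - d) / t) \<longlongrightarrow> r * (a 1 - d)) (at_right 0)" by (fact lo)
    have "((\<lambda>t. err t / t) \<longlongrightarrow> 0) (at_right 0)"
      using r unfolding err_def by real_asymp
    from tendsto_add[OF lo this]
    show "((\<lambda>t. (lo t + err t - d) / t) \<longlongrightarrow> r * (a 1 - d)) (at_right 0)"
      by (simp add: diff_divide_distrib add_divide_distrib algebra_simps)
  qed
  then show ?thesis unfolding a0(2) d_def .
qed

text \<open>Uniformization: once \<open>r\<close> dominates all exit rates
  \<open>- (Q $ x $ x)\<close>, the rows of \<open>I + Q / r\<close> are probability mass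
  functions.\<close>

lemma rate_matrix_jump_kernel:
  fixes Q :: "real^'x^'x::finite"
  assumes "rate_matrix Q"
  obtains A r where "0 < r" and "\<And>x y. Q $ x $ y = r * (pmf (A x) y - (if x = y then 1 else 0))"
proof -
  \<comment> \<open>The sum dominates every single exit rate; the summand 1 keeps \<open>r\<close>
    positive when \<open>Q\<close> is zero.\<close>
  define r where "r = 1 + (\<Sum>x\<in>UNIV. \<bar>Q $ x $ x\<bar>)"
  have r: "0 < r" unfolding r_def by (simp add: add_pos_nonneg sum_nonneg)
  have le: "- (Q $ x $ x) \<le> r" for x
    using member_le_sum[of x UNIV "\<lambda>x. \<bar>Q $ x $ x\<bar>"] by (auto simp: r_def)
  define g where "g x y = (if x = y then 1 else 0) + Q $ x $ y / r" for x y
  have nonneg: "0 \<le> g x y" for x y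
    using assms r le[of x] by (auto simp: g_def rate_matrix_def field_simps)
  have "(\<Sum>y\<in>UNIV. g x y) = 1" for x
    using assms by (simp add: g_def rate_matrix_def sum.distrib sum_divide_distrib[symmetric])
  then have "(\<integral>\<^sup>+y. ennreal (g x y) \<partial>count_space UNIV) = 1" for x
    using nonneg by (simp add: nn_integral_count_space_finite)
  then have "pmf (embed_pmf (g x)) y = g x y" for x y
    using nonneg by (simp add: pmf_embed_pmf)
  then show ?thesis
    using r by (intro that[of r "\<lambda>x. embed_pmf (g x)"]) (auto simp: g_def)
qed

section \<open>Markov chains on a finite grid of times\<close>

text \<open>The path \<open>g\<close> is overwritten at the grid times in turn and kept elsewhere;
  \<open>t\<close> is the current time, and the current state is read off as
  \<open>g t\<close>.\<close>

primrec chain :: "(real \<Rightarrow> 'x \<Rightarrow> 'x pmf) \<Rightarrow> real \<Rightarrow> real list \<Rightarrow> (real \<Rightarrow> 'x) \<Rightarrow> (real \<Rightarrow> 'x) pmf" where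
  "chain k t [] g = return_pmf g"
| "chain k t (s # ss) g = bind_pmf (k (s - t) (g t)) (\<lambda>z. chain k s ss (g(s := z)))"

lemma chain_unchanged:
  "\<omega> \<in> set_pmf (chain k t ss g) \<Longrightarrow> r \<notin> set ss \<Longrightarrow> \<omega> r = g r"
  by (induction ss arbitrary: t g) fastforce+

text \<open>In an increasing grid each step has positive length, so the fully supported kernel can
  pick the value that \<open>h\<close> prescribes.\<close>

lemma set_pmf_chain:
  assumes "sorted_wrt (<) (t # ss)" and "\<And>a x. 0 < a \<Longrightarrow> set_pmf (k a x) = UNIV"
  shows "(\<lambda>r. if r \<in> set ss then h r else g r) \<in> set_pmf (chain k t ss g)"
  using assms(1)
proof (induction ss arbitrary: t g)
  case (Cons s ss)
  have eq: "(\<lambda>r. if r \<in> set (s # ss) then h r else g r) =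
      (\<lambda>r. if r \<in> set ss then h r else (g(s := h s)) r)"
    by auto
  show ?case unfolding eq using Cons by (force simp: assms(2))
qed simp

lemma measure_chain_unchanged:
  assumes "\<And>\<omega>. \<omega> \<in> set_pmf (chain k t ss g) \<Longrightarrow> \<omega> \<in> S \<longleftrightarrow> c"
  shows "measure (chain k t ss g) S = (if c then 1 else 0)"
proof (cases c)
  case True
  then show ?thesis
    using assms by (auto intro!: measure_pmf.prob_eq_1[THEN iffD2] simp: AE_measure_pmf_iff)
next
  case False
  then show ?thesis using assms by (auto simp: measure_pmf_zero_iff)
qed

context
  fixes k :: "real \<Rightarrow> 'x::finite \<Rightarrow> 'x pmf"
  assumes k_add: "\<And>a b x. 0 < a \<Longrightarrow> 0 < b \<Longrightarrow> bind_pmf (k a x) (k b) = k (a + b) x"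
begin

text \<open>Chapman-Kolmogorov integrates out the grid times strictly between \<open>t\<close> and
  \<open>s\<close>, and later steps leave the coordinate \<open>s\<close> alone.\<close>

lemma measure_chain_marginal:
  assumes "sorted_wrt (<) (t # ss)" "s \<in> set ss"
  shows "measure (chain k t ss g) {\<omega>. \<omega> s = y} = pmf (k (s - t) (g t)) y"
  using assms
proof (induction ss arbitrary: t g)
  case (Cons r ss)
  show ?case
  proof (cases "s = r")
    case True
    have "measure (chain k r ss (g(r := z))) {\<omega>. \<omega> s = y} = (if z = y then 1 else 0)" for z
      by (rule measure_chain_unchanged) (use Cons.prems True in \<open>auto dest!: chain_unchanged[of _ k r ss _ r]\<close>)
    note * = this
    show ?thesis
      using True unfolding chain.simps measure_bind_pmf_finite *
      by (simp add: if_distrib cong: if_cong)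
  next
    case False
    then have s: "s \<in> set ss" "r < s" "t < r" using Cons.prems by auto
    then have "measure (chain k r ss (g(r := z))) {\<omega>. \<omega> s = y} = pmf (k (s - r) z) y" for z
      using Cons by simp
    then have "measure (chain k t (r # ss) g) {\<omega>. \<omega> s = y} = pmf (bind_pmf (k (r - t) (g t)) (k (s - r))) y"
      by (simp add: measure_bind_pmf_finite pmf.rep_eq)
    also have "\<dots> = pmf (k (s - t) (g t)) y"
      using s by (subst k_add) auto
    finally show ?thesis .
  qed
qed simp

text \<open>The induction runs along the grid until the current time is \<open>t\<close>. Until then
  both sides average over the same first step; at \<open>t\<close> the past is settled and the
  marginal law applies. The product form also covers conditioning events of probability
  zero.\<close>

lemma measure_chain_Markov:
  assumes "sorted_wrt (<) (t0 # ss)" "t \<in> set (t0 # ss)" "s \<in> set ss" "t < s"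
    and "t \<in> w" "\<forall>r\<in>w. r \<le> t"
  shows "measure (chain k t0 ss g) {\<omega>. (\<forall>r\<in>w. \<omega> r = x r) \<and> \<omega> s = y} =
    pmf (k (s - t) (x t)) y * measure (chain k t0 ss g) {\<omega>. \<forall>r\<in>w. \<omega> r = x r}"
  using assms(1-3)
proof (induction ss arbitrary: t0 g)
  case (Cons r ss)
  show ?case
  proof (cases "t = t0")
    case True
    \<comment> \<open>No remaining grid time lies in \<open>w\<close>, so the event on
      \<open>w\<close> is already decided by \<open>g\<close>.\<close>
    have w: "q \<notin> set (r # ss)" if "q \<in> w" for q
      using that Cons.prems(1) assms(6) True by force
    then have agree: "(\<forall>q\<in>w. \<omega> q = x q) \<longleftrightarrow> (\<forall>q\<in>w. g q = x q)"
      if "\<omega> \<in> set_pmf (chain k t0 (r # ss) g)" for \<omega>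
      using chain_unchanged[OF that] by metis
    show ?thesis
    proof (cases "\<forall>q\<in>w. g q = x q")
      case g: True
      have "measure (chain k t0 (r # ss) g) {\<omega>. (\<forall>r\<in>w. \<omega> r = x r) \<and> \<omega> s = y} =
          measure (chain k t0 (r # ss) g) {\<omega>. \<omega> s = y}"
        by (rule measure_pmf.finite_measure_eq_AE)
          (use agree g in \<open>auto simp: AE_measure_pmf_iff simp del: chain.simps\<close>)
      also have "\<dots> = pmf (k (s - t) (x t)) y"
        using measure_chain_marginal[OF Cons.prems(1,3)] g assms(5) True by (simp del: chain.simps)
      moreover have "measure (chain k t0 (r # ss) g) {\<omega>. \<forall>r\<in>w. \<omega> r = x r} = 1"
        using measure_chain_unchanged[of k t0 "r # ss" g "{\<omega>. \<forall>r\<in>w. \<omega> r = x r}" True] agree g by auto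
      ultimately show ?thesis by simp
    next
      case False
      then show ?thesis
        using measure_chain_unchanged[of k t0 "r # ss" g "{\<omega>. \<forall>r\<in>w. \<omega> r = x r}" False]
          measure_chain_unchanged[of k t0 "r # ss" g "{\<omega>. (\<forall>r\<in>w. \<omega> r = x r) \<and> \<omega> s = y}" False] agree
        by auto
    qed
  next
    case False
    then have "t \<in> set (r # ss)" "s \<in> set ss" using Cons.prems \<open>t < s\<close> by auto
    then show ?thesis
      using Cons by (simp add: measure_bind_pmf_finite sum_distrib_left mult_ac)
  qed
qed simp

end

definition grid :: "real set \<Rightarrow> real list" where
  "grid G = sorted_list_of_set (G \<inter> {0<..})"

text \<open>The grid lists positive times only, because time 0 gets its state from \<open>p\<close>.
  At times outside the grid the constant starting path is a mere filler.\<close>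

definition chain_law :: "'x pmf \<Rightarrow> (real \<Rightarrow> 'x \<Rightarrow> 'x pmf) \<Rightarrow> real set \<Rightarrow> (real \<Rightarrow> 'x) pmf" where
  "chain_law p k G = bind_pmf p (\<lambda>x. chain k 0 (grid G) (\<lambda>_. x))"

lemma grid_sorted: "finite G \<Longrightarrow> sorted_wrt (<) (0 # grid G)"
  and set_grid: "finite G \<Longrightarrow> set (grid G) = G \<inter> {0<..}"
  by (auto simp: grid_def)

text \<open>Spreads the law of the chain on the grid over paths so that all paths in \<open>F\<close> are charged.\<close>

definition path_law ::
  "'x pmf \<Rightarrow> (real \<Rightarrow> 'x \<Rightarrow> 'x pmf) \<Rightarrow> real set \<Rightarrow> (real \<Rightarrow> 'x) set \<Rightarrow> (real \<Rightarrow> 'x) pmf" where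
  "path_law p k G F = bind_pmf (chain_law p k G) (\<lambda>g. pmf_of_set
     (insert (restrict g {0..}) {\<omega>\<in>F \<inter> paths. \<forall>t\<in>insert 0 (G \<inter> {0<..}). \<omega> t = g t}))"

text \<open>A draw \<open>g\<close> is replaced only by paths that agree with it at time 0 and on
  the grid, which leaves events determined by such times unaffected.\<close>

lemma measure_path_law:
  assumes "finite F" "w \<subseteq> insert 0 (G \<inter> {0<..})"
    and "\<And>\<omega> \<omega>'. (\<forall>t\<in>w. \<omega> t = \<omega>' t) \<Longrightarrow> R \<omega> \<longleftrightarrow> R \<omega>'"
  shows "measure (path_law p k G F) {\<omega>\<in>paths. R \<omega>} = measure (chain_law p k G) {\<omega>. R \<omega>}"
proof -
  have "measure (pmf_of_set (insert (restrict g {0..})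
      {\<omega>\<in>F \<inter> paths. \<forall>t\<in>insert 0 (G \<inter> {0<..}). \<omega> t = g t})) {\<omega>\<in>paths. R \<omega>} = (if R g then 1 else 0)"
    (is "measure (pmf_of_set ?N) _ = _") for g
  proof -
    \<comment> \<open>\<open>restrict g {0..}\<close> keeps the set non-empty when no path in
      \<open>F\<close> matches \<open>g\<close>.\<close>
    have N: "finite ?N" "?N \<noteq> {}" using assms(1) by auto
    have eq: "R \<omega> \<longleftrightarrow> R g" "\<omega> \<in> paths" if "\<omega> \<in> ?N" for \<omega>
    proof -
      have "\<forall>t\<in>w. \<omega> t = g t" using that assms(2) by auto
      then show "R \<omega> \<longleftrightarrow> R g" by (rule assms(3))
      have "restrict g {0..} \<in> paths" by (simp add: paths_def)
      then show "\<omega> \<in> paths" using that by auto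
    qed
    show ?thesis
    proof (cases "R g")
      case True
      then have "?N \<inter> {\<omega>\<in>paths. R \<omega>} = ?N" using eq by blast
      then show ?thesis using True N by (simp add: measure_pmf_of_set del: Int_insert_left_if0 Int_insert_left_if1)
    next
      case False
      then have "?N \<inter> {\<omega>\<in>paths. R \<omega>} = {}" using eq by blast
      then show ?thesis using False N by (simp add: measure_pmf_of_set del: Int_insert_left_if0 Int_insert_left_if1)
    qed
  qed
  note * = this
  have "emeasure (path_law p k G F) {\<omega>\<in>paths. R \<omega>} = (\<integral>\<^sup>+g. indicator {\<omega>. R \<omega>} g \<partial>chain_law p k G)"
    unfolding path_law_def emeasure_bind_pmf
    by (simp only: measure_pmf.emeasure_eq_measure[of "pmf_of_set _"] *)
      (auto intro!: nn_integral_cong simp: indicator_def)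
  then show ?thesis
    by (simp add: measure_def)
qed

lemma mem_path_law:
  assumes "finite F" "\<omega> \<in> F" "\<omega> \<in> paths" "finite G"
    and "set_pmf p = UNIV" "\<And>a x. 0 < a \<Longrightarrow> set_pmf (k a x) = UNIV"
  shows "\<omega> \<in> set_pmf (path_law p k G F)"
proof -
  \<comment> \<open>\<open>g\<close> copies the path on the grid and rests at its initial state
    elsewhere: a draw that the chain started in \<open>\<omega> 0\<close> can make, and one whose
    spread contains \<open>\<omega>\<close>.\<close>
  define g where "g = (\<lambda>r. if r \<in> set (grid G) then \<omega> r else \<omega> 0)"
  have "g \<in> set_pmf (chain k 0 (grid G) (\<lambda>_. \<omega> 0))"
    unfolding g_def using assms by (intro set_pmf_chain grid_sorted) auto
  then have "g \<in> set_pmf (chain_law p k G)"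
    using assms by (auto simp: chain_law_def)
  moreover have "\<forall>t\<in>insert 0 (G \<inter> {0<..}). \<omega> t = g t"
    using assms by (auto simp: g_def set_grid)
  ultimately show ?thesis
    unfolding path_law_def set_bind_pmf
    using assms by (intro UN_I[of g]) (auto simp: set_pmf_of_set)
qed

lemma chain_law_initial:
  fixes p :: "'x::finite pmf"
  assumes "finite G"
  shows "measure (chain_law p k G) {\<omega>. \<omega> 0 = x} = pmf p x"
proof -
  have "measure (chain k 0 (grid G) (\<lambda>_. z)) {\<omega>. \<omega> 0 = x} = (if z = x then 1 else 0)" for z
    by (rule measure_chain_unchanged)
      (use assms in \<open>auto simp: set_grid dest!: chain_unchanged[of _ k 0 "grid G" _ 0]\<close>)
  note * = this
  show ?thesis
    unfolding chain_law_def measure_bind_pmf_finite *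
    by (simp add: if_distrib cong: if_cong)
qed

lemma chain_law_Markov:
  fixes p :: "'x::finite pmf"
  assumes "\<And>a b x. 0 < a \<Longrightarrow> 0 < b \<Longrightarrow> bind_pmf (k a x) (k b) = k (a + b) x"
    and "finite G" "t \<in> insert 0 (G \<inter> {0<..})" "s \<in> G" "t < s" "t \<in> w" "\<forall>r\<in>w. r \<le> t"
  shows "measure (chain_law p k G) {\<omega>. (\<forall>r\<in>w. \<omega> r = x r) \<and> \<omega> s = y} =
    pmf (k (s - t) (x t)) y * measure (chain_law p k G) {\<omega>. \<forall>r\<in>w. \<omega> r = x r}"
proof -
  have "s \<in> set (grid G)" "t \<in> set (0 # grid G)"
    using assms by (auto simp: set_grid)
  note * = measure_chain_Markov[OF assms(1) grid_sorted[OF assms(2)] this(2,1) assms(5-7)]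
  show ?thesis
    unfolding chain_law_def measure_bind_pmf_finite
    by (subst *) (simp_all add: sum_distrib_left mult_ac)
qed

section \<open>Existence of imprecise Markov chains\<close>

text \<open>Mixing in the uniform distribution gives full support for each \<open>n\<close>, with a
  weight that vanishes as \<open>n\<close> grows.\<close>

definition perturb :: "nat \<Rightarrow> 'x::finite pmf \<Rightarrow> 'x pmf" where
  "perturb n q = bind_pmf (bernoulli_pmf (1 / real (Suc n))) (\<lambda>b. if b then pmf_of_set UNIV else q)"

lemma set_pmf_perturb: "set_pmf (perturb n q) = UNIV"
proof -
  have "True \<in> set_pmf (bernoulli_pmf (1 / real (Suc n)))"
    by (simp add: set_pmf_iff)
  then show ?thesis by (force simp: perturb_def)
qed

lemma tendsto_pmf_perturb: "(\<lambda>n. pmf (perturb n q) y) \<longlonglongrightarrow> pmf q y"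
proof -
  have eq: "pmf (perturb n q) y =
      1 / real (Suc n) * pmf (pmf_of_set UNIV) y + (1 - 1 / real (Suc n)) * pmf q y" for n
    by (simp add: perturb_def pmf_bind del: of_nat_Suc)
  have "(\<lambda>n. 1 / real (Suc n)) \<longlonglongrightarrow> 0"
    by real_asymp
  then have "(\<lambda>n. pmf (perturb n q) y) \<longlonglongrightarrow> 0 * pmf (pmf_of_set UNIV) y + (1 - 0) * pmf q y"
    unfolding eq by (intro tendsto_intros)
  then show ?thesis by simp
qed

text \<open>One homogeneous chain with rate matrix \<open>Q\<close> suffices: its difference
  quotients converge to \<open>Q\<close> after every history, so they remain bounded near 0 and have
  \<open>Q\<close> as their only limit point.\<close>

lemma ictmc_nonempty:
  fixes Q :: "real^'x^'x::finite"
  assumes Q: "Q \<in> \<Q>" "rate_matrix Q" and p: "p \<in> \<M>"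
  shows "ictmc \<Q> \<M> \<noteq> {}"
proof -
  obtain A r where r: "0 < r" and A: "\<And>x y. Q $ x $ y = r * (pmf (A x) y - (if x = y then 1 else 0))"
    by (rule rate_matrix_jump_kernel[OF Q(2)]) (rule that)
  define K where "K n = jump_kernel (\<lambda>x. perturb n (A x)) r" for n
  define m where "m = (\<lambda>(G, F, n). path_law (perturb n p) (K n) G F)"
  \<comment> \<open>Along this filter the grid and the path set exceed any given finite sets while
    the perturbation index tends to infinity.\<close>
  define \<F> :: "(real set \<times> (real \<Rightarrow> 'x) set \<times> nat) filter"
    where "\<F> = finite_subsets_at_top UNIV \<times>\<^sub>F finite_subsets_at_top UNIV \<times>\<^sub>F sequentially"
  have \<F>: "\<F> \<noteq> bot"
    by (simp add: \<F>_def prod_filter_eq_bot)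
  have K_add: "bind_pmf (K n a x) (K n b) = K n (a + b) x" if "0 < a" "0 < b" for n a b x
    unfolding K_def using r that by (rule jump_kernel_add)
  have K_full: "set_pmf (K n a x) = UNIV" if "0 < a" for n a x
    unfolding K_def using r that by (rule set_pmf_jump_kernel) (rule set_pmf_perturb)
  have eventually_\<F>: "eventually (\<lambda>(G, F, n). finite G \<and> W \<subseteq> G \<and> finite F \<and> V \<subseteq> F) \<F>"
    if "finite W" "finite V" for W V
  proof -
    have "eventually (\<lambda>G. finite G \<and> W \<subseteq> G) (finite_subsets_at_top UNIV)"
      "eventually (\<lambda>F. finite F \<and> V \<subseteq> F) (finite_subsets_at_top UNIV)"
      using that by (auto simp: eventually_finite_subsets_at_top)
    then have "eventually (\<lambda>(G, F). finite G \<and> W \<subseteq> G) \<F>"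
      "eventually (\<lambda>(G, F, n). finite F \<and> V \<subseteq> F) \<F>"
      by (simp_all add: \<F>_def eventually_prod1 eventually_prod2 prod_filter_eq_bot)
    then show ?thesis
      by eventually_elim auto
  qed
  have charge: "\<omega> \<in> set_pmf (m (G, F, n))" if "finite G" "finite F" "\<omega> \<in> F" "\<omega> \<in> paths" for \<omega> G F n
    unfolding m_def using that by (auto intro!: mem_path_law set_pmf_perturb K_full)
  have charged: "eventually (\<lambda>i. \<omega> \<in> set_pmf (m i)) \<F>" if "\<omega> \<in> paths" for \<omega>
    using eventually_\<F>[OF finite.emptyI, of "{\<omega>}"] that charge by (auto elim!: eventually_mono)
  obtain P' where P': "full_conditional_probability paths P'"
    and lim: "\<And>A C L. ((\<lambda>i. measure (m i) (A \<inter> C) / measure (m i) C) \<longlongrightarrow> L) \<F> \<Longrightarrow> P' A C = L"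
    using full_conditional_probability_limit[OF \<F>, of paths m, OF charged] by auto
  have snd_seq: "filterlim (\<lambda>i. snd (snd i)) sequentially \<F>"
    unfolding \<F>_def by (rule filterlim_compose[OF filterlim_snd filterlim_snd])
  have trans: "P' {\<omega>\<in>paths. \<omega> s = y} (state_event w x) = pmf (jump_kernel A r (s - t) (x t)) y"
    if w: "finite w" "w \<subseteq> {0..}" "t \<in> w" "\<forall>r\<in>w. r \<le> t" "t < s" for s t w x y
  proof (rule lim)
    have t: "0 \<le> t" using w by auto
    \<comment> \<open>A path that meets the condition; once it lies in \<open>F\<close>, the
      conditioning event has positive mass and can be divided by.\<close>
    obtain \<omega> where \<omega>: "\<omega> \<in> paths" "\<forall>r\<in>w. \<omega> r = x r"
      using w by (intro that[of "restrict x {0..}"]) (auto simp: paths_def)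
    \<comment> \<open>As soon as the grid contains \<open>insert s w\<close> and \<open>F\<close>
      contains \<open>\<omega>\<close>, the quotient equals the perturbed kernel exactly; only the
      perturbation is left for the limit.\<close>
    have "eventually (\<lambda>i. measure (m i) ({\<omega>\<in>paths. \<omega> s = y} \<inter> state_event w x) / measure (m i) (state_event w x) =
        pmf (K (snd (snd i)) (s - t) (x t)) y) \<F>"
      using eventually_\<F>[OF finite.insertI[OF w(1)], of "{\<omega>}" s, OF finite.insertI[OF finite.emptyI]]
    proof (eventually_elim, clarsimp)
      fix G F n assume G: "finite G" "s \<in> G" "w \<subseteq> G" "finite F" "\<omega> \<in> F"
      have sub: "w \<subseteq> insert 0 (G \<inter> {0<..})" "insert s w \<subseteq> insert 0 (G \<inter> {0<..})"
        using w G t by force+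
      have C: "state_event w x = {\<omega>\<in>paths. \<forall>r\<in>w. \<omega> r = x r}"
        by (simp add: state_event_def)
      have AC: "{\<omega>\<in>paths. \<omega> s = y} \<inter> state_event w x = {\<omega>\<in>paths. (\<forall>r\<in>w. \<omega> r = x r) \<and> \<omega> s = y}"
        by (auto simp: state_event_def)
      have "measure (m (G, F, n)) ({\<omega>\<in>paths. \<omega> s = y} \<inter> state_event w x) =
          measure (chain_law (perturb n p) (K n) G) {\<omega>. (\<forall>r\<in>w. \<omega> r = x r) \<and> \<omega> s = y}"
        unfolding AC m_def by (simp, rule measure_path_law[OF G(4) sub(2)]) auto
      also have "\<dots> = pmf (K n (s - t) (x t)) y *
          measure (chain_law (perturb n p) (K n) G) {\<omega>. \<forall>r\<in>w. \<omega> r = x r}"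
        by (rule chain_law_Markov) (use w G t K_add sub in auto)
      also have "measure (chain_law (perturb n p) (K n) G) {\<omega>. \<forall>r\<in>w. \<omega> r = x r} =
          measure (m (G, F, n)) (state_event w x)"
        unfolding C m_def by (simp, rule measure_path_law[OF G(4) sub(1), symmetric]) auto
      moreover have "measure (m (G, F, n)) (state_event w x) \<noteq> 0"
        using charge[of G F \<omega> n] G \<omega> by (auto simp: measure_pmf_zero_iff C)
      ultimately show "measure (m (G, F, n)) ({\<omega>\<in>paths. \<omega> s = y} \<inter> state_event w x) /
          measure (m (G, F, n)) (state_event w x) = pmf (K n (s - t) (x t)) y"
        by simp
    qed
    moreover have "((\<lambda>i. pmf (K (snd (snd i)) (s - t) (x t)) y) \<longlongrightarrow> pmf (jump_kernel A r (s - t) (x t)) y) \<F>"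
      unfolding K_def
      by (rule filterlim_compose[OF tendsto_pmf_jump_kernel snd_seq]) (rule tendsto_pmf_perturb)
    ultimately show "((\<lambda>i. measure (m i) ({\<omega>\<in>paths. \<omega> s = y} \<inter> state_event w x) /
        measure (m i) (state_event w x)) \<longlongrightarrow> pmf (jump_kernel A r (s - t) (x t)) y) \<F>"
      by (simp add: tendsto_cong)
  qed
  have init: "P' {\<omega>\<in>paths. \<omega> 0 = x} paths = pmf p x" for x
  proof (rule lim)
    have "eventually (\<lambda>i. measure (m i) ({\<omega>\<in>paths. \<omega> 0 = x} \<inter> paths) / measure (m i) paths =
        pmf (perturb (snd (snd i)) p) x) \<F>"
      using eventually_\<F>[OF finite.emptyI finite.emptyI]
    proof (eventually_elim, clarsimp)
      fix G :: "real set" and F :: "(real \<Rightarrow> 'x) set" and n assume G: "finite G" "finite F"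
      have "measure (m (G, F, n)) {\<omega>\<in>paths. \<omega> 0 = x} = measure (chain_law (perturb n p) (K n) G) {\<omega>. \<omega> 0 = x}"
        unfolding m_def by (simp, rule measure_path_law[OF G(2), of "{0}"]) auto
      \<comment> \<open>All mass sits on \<open>paths\<close>, so the denominator is 1.\<close>
      moreover have "measure (m (G, F, n)) {\<omega>\<in>paths. True} = measure (chain_law (perturb n p) (K n) G) {\<omega>. True}"
        unfolding m_def by (simp, rule measure_path_law[OF G(2), of "{}" _ "\<lambda>_. True", simplified])
      moreover have "{\<omega>\<in>paths. \<omega> 0 = x} \<inter> paths = {\<omega>\<in>paths. \<omega> 0 = x}"
        by auto
      ultimately show "measure (m (G, F, n)) ({\<omega>\<in>paths. \<omega> 0 = x} \<inter> paths) / measure (m (G, F, n)) paths =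
          pmf (perturb n p) x"
        by (simp add: chain_law_initial G)
    qed
    moreover have "((\<lambda>i. pmf (perturb (snd (snd i)) p) x) \<longlongrightarrow> pmf p x) \<F>"
      by (rule filterlim_compose[OF tendsto_pmf_perturb snd_seq])
    ultimately show "((\<lambda>i. measure (m i) ({\<omega>\<in>paths. \<omega> 0 = x} \<inter> paths) / measure (m i) paths) \<longlongrightarrow> pmf p x) \<F>"
      by (simp add: tendsto_cong)
  qed
  define P where "P A u x = P' A (state_event u x)" for A u x
  have P_trans: "transition_matrix P u xu t s $ x $ y = pmf (jump_kernel A r (s - t) x) y"
    if "history t u xu" "0 \<le> t" "t < s" for u xu t s x y
    using that trans[of "insert t u" t s y "xu(t := x)"]
    by (force simp: transition_matrix_def P_def history_def)
  have quot: "((\<lambda>\<Delta>. (1 / \<Delta>) *\<^sub>R (T \<Delta> - mat 1)) \<longlongrightarrow> Q) (at_right 0)"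
    if "eventually (\<lambda>\<Delta>. \<forall>x y. T \<Delta> $ x $ y = pmf (jump_kernel A r \<Delta> x) y) (at_right 0)" for T :: "real \<Rightarrow> real^'x^'x"
  proof (intro vec_tendstoI)
    fix x y
    have "((\<lambda>\<Delta>. (pmf (jump_kernel A r \<Delta> x) y - (if x = y then 1 else 0)) / \<Delta>) \<longlongrightarrow> Q $ x $ y) (at_right 0)"
      unfolding A by (rule jump_kernel_right_derivative[OF r])
    then show "((\<lambda>\<Delta>. ((1 / \<Delta>) *\<^sub>R (T \<Delta> - mat 1)) $ x $ y) \<longlongrightarrow> Q $ x $ y) (at_right 0)"
      by (rule Lim_transform_eventually)
        (use that in eventually_elim, simp add: mat_def)
  qed
  have right: "(right_quotient P u xu t \<longlongrightarrow> Q) (at_right 0)"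
    if "history t u xu" "0 \<le> t" for u xu t
    unfolding right_quotient_def[abs_def]
    by (rule quot) (use that in \<open>auto simp: P_trans eventually_at_filter\<close>)
  have left: "(left_quotient P u xu t \<longlongrightarrow> Q) (at_right 0)"
    if h: "history t u xu" "0 < t" for u xu t
    unfolding left_quotient_def[abs_def]
  proof (rule quot)
    \<comment> \<open>For small \<Delta> the time \<open>t - \<Delta>\<close> still lies after the
      whole finite history, so the transition formula applies from there.\<close>
    have "eventually (\<lambda>\<Delta>. \<forall>r\<in>u. r < t - \<Delta>) (at_right (0::real))"
    proof (rule eventually_ball_finite)
      show "finite u" using h by (simp add: history_def)
      show "\<forall>r\<in>u. \<forall>\<^sub>F \<Delta> in at_right 0. r < t - \<Delta>"
      proof
        fix r assume "r \<in> u"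
        then have "0 < t - r" using h by (auto simp: history_def)
        then show "\<forall>\<^sub>F \<Delta> in at_right 0. r < t - \<Delta>"
          using eventually_at_right_real[of 0 "t - r"] by (auto elim!: eventually_mono)
      qed
    qed
    moreover have "eventually (\<lambda>\<Delta>. \<Delta> \<in> {0<..<t}) (at_right 0)"
      by (rule eventually_at_right_real[OF h(2)])
    ultimately show "\<forall>\<^sub>F \<Delta> in at_right 0. \<forall>x y. transition_matrix P u xu (t - \<Delta>) t $ x $ y = pmf (jump_kernel A r \<Delta> x) y"
    proof eventually_elim
      case (elim \<Delta>)
      then have "history (t - \<Delta>) u xu" using h by (auto simp: history_def)
      then show ?case using elim P_trans[of "t - \<Delta>" u xu t] by auto
    qed
  qed
  have bfun: "Bfun F (at_right 0)" if "(F \<longlongrightarrow> Q) (at_right 0)" for F :: "real \<Rightarrow> real^'x^'x"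
  proof -
    have "eventually (\<lambda>\<Delta>. dist (F \<Delta>) Q < 1) (at_right 0)"
      using that by (rule tendstoD) simp
    then show ?thesis
      unfolding Bfun_metric_def by (intro exI[of _ Q] exI[of _ 1]) (auto elim!: eventually_mono)
  qed
  have limpt: "limit_points_at_0 F \<subseteq> \<Q>" if F: "(F \<longlongrightarrow> Q) (at_right 0)" for F :: "real \<Rightarrow> real^'x^'x"
  proof
    fix L assume "L \<in> limit_points_at_0 F"
    then obtain \<delta> :: "nat \<Rightarrow> real" where \<delta>: "\<And>n. 0 < \<delta> n" "\<delta> \<longlonglongrightarrow> 0" "(\<lambda>n. F (\<delta> n)) \<longlonglongrightarrow> L"
      by (auto simp: limit_points_at_0_def)
    have "\<delta> n \<noteq> 0" for n using \<delta>(1)[of n] by simp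
    with \<delta> have "filterlim \<delta> (at_right 0) sequentially"
      by (simp add: filterlim_at)
    then have "(\<lambda>n. F (\<delta> n)) \<longlonglongrightarrow> Q" by (rule filterlim_compose[OF F])
    then have "L = Q" using \<delta>(3) LIMSEQ_unique by blast
    then show "L \<in> \<Q>" using Q by simp
  qed
  have "stochastic_process P"
    unfolding stochastic_process_def P_def using P' by blast
  moreover have "well_behaved P"
    unfolding well_behaved_def using bfun right left by blast
  moreover have "consistent_with \<Q> P"
    unfolding consistent_with_def using limpt right left by blast
  moreover have "uncond P {\<omega>\<in>paths. \<omega> 0 = x} = pmf p x" for x
    using init by (simp add: uncond_def P_def state_event_def)
  ultimately have "P \<in> ictmc \<Q> \<M>"
    using p by (auto simp: ictmc_def)
  then show ?thesis by auto
qed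

section \<open>Marginals and expectations\<close>

lemma finite_states [simp]: "finite w \<Longrightarrow> finite (states w :: (real \<Rightarrow> 'x::finite) set)"
  by (simp add: states_def finite_PiE)

lemma restrict_in_states [simp]: "restrict x w \<in> states w"
  by (simp add: states_def)

lemma state_event_subset: "state_event w x \<subseteq> paths"
  by (auto simp: state_event_def)

text \<open>With nothing conditioned on, every time from 0 on contributes generators, and the event
  is a finite intersection of them. A process is tied to its full conditional extension only on this
  algebra.\<close>

lemma state_event_in_event_algebra:
  assumes "finite w" "w \<subseteq> {0..}"
  shows "state_event w x \<in> event_algebra {}"
proof -
  have "state_event w x \<in> T"
    if T: "algebra paths T" and sub: "{{\<omega>\<in>paths. \<omega> s = x} | s x. 0 \<le> s} \<subseteq> T" for T
    using assms
  proof (induction w rule: finite_induct)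
    case empty
    then show ?case using algebra.top[OF T] by (simp add: state_event_def)
  next
    case (insert t w)
    have "{\<omega>\<in>paths. \<omega> t = x t} \<in> T" using insert.prems sub by auto
    moreover have "state_event w x \<in> T" using insert by auto
    ultimately have "{\<omega>\<in>paths. \<omega> t = x t} \<inter> state_event w x \<in> T"
      using T by (simp add: algebra_iff_Int)
    also have "{\<omega>\<in>paths. \<omega> t = x t} \<inter> state_event w x = state_event (insert t w) x"
      by (auto simp: state_event_def)
    finally show ?case .
  qed
  then show ?thesis by (simp add: event_algebra_def hull_def)
qed

lemma paths_nonempty: "(paths :: (real \<Rightarrow> 'x) set) \<noteq> {}"
  by (simp add: paths_def PiE_eq_empty_iff)

text \<open>The extension \<open>q\<close> is additive on all subsets of \<open>paths\<close>, so
  unions can be formed without checking membership in the algebra.\<close>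

lemma stochastic_process_additive:
  fixes P :: "'x process"
  assumes "stochastic_process P"
  shows "\<exists>q. (\<forall>A\<subseteq>paths. 0 \<le> q A) \<and> q paths = 1 \<and>
    (\<forall>A B. A \<subseteq> paths \<and> B \<subseteq> paths \<and> A \<inter> B = {} \<longrightarrow> q (A \<union> B) = q A + q B) \<and>
    (\<forall>w x. finite w \<and> w \<subseteq> {0..} \<longrightarrow> uncond P (state_event w x) = q (state_event w x))"
proof -
  obtain P' where P': "full_conditional_probability paths P'"
    and ext: "\<forall>u x A. finite u \<and> u \<subseteq> {0..} \<and> x \<in> states u \<and> A \<in> event_algebra u \<longrightarrow>
          P A u x = P' A (state_event u x)"
    using assms unfolding stochastic_process_def by (elim exE conjE)
  have empty: "state_event {} x = paths" for x :: "real \<Rightarrow> 'x"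
    by (simp add: state_event_def)
  have "uncond P (state_event w x) = P' (state_event w x) paths" if "finite w" "w \<subseteq> {0..}" for w x
    using ext[rule_format, of "{}" "\<lambda>_. undefined" "state_event w x"] state_event_in_event_algebra[OF that, of x]
    by (simp add: uncond_def empty states_def)
  then show ?thesis
    using P'[unfolded full_conditional_probability_def, rule_format, of paths]
      paths_nonempty[where 'x='x]
    by (intro exI[of _ "\<lambda>A. P' A paths"]) simp
qed

lemma process_state_event_nonneg:
  assumes "stochastic_process P" "finite w" "w \<subseteq> {0..}"
  shows "0 \<le> uncond P (state_event w x)"
  using stochastic_process_additive[OF assms(1)] assms(2,3) state_event_subset[of w x] by auto

text \<open>The event is the disjoint union of its refinements to \<open>w\<close>, and
  \<open>q\<close> is finitely additive.\<close>

lemma process_marginal: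
  fixes P :: "'x::finite process"
  assumes P: "stochastic_process P" and w: "finite w" "w \<subseteq> {0..}" and u: "u \<subseteq> w"
  shows "uncond P (state_event u z) =
    (\<Sum>x\<in>{x \<in> states w. \<forall>t\<in>u. x t = z t}. uncond P (state_event w x))"
proof -
  obtain q where q: "\<forall>A B. A \<subseteq> paths \<and> B \<subseteq> paths \<and> A \<inter> B = {} \<longrightarrow> q (A \<union> B) = q A + q B"
    and "\<forall>w x. finite w \<and> w \<subseteq> {0..} \<longrightarrow> uncond P (state_event w x) = q (state_event w x)"
    using stochastic_process_additive[OF P] by (elim exE conjE)
  then have uncond: "uncond P (state_event w x) = q (state_event w x)" if "finite w" "w \<subseteq> {0..}" for w x
    using that by simp
  have add: "q (A \<union> B) = q A + q B" if "A \<subseteq> paths" "B \<subseteq> paths" "A \<inter> B = {}" for A B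
    using q that by simp
  have sum: "q (\<Union>x\<in>I. state_event w x) = (\<Sum>x\<in>I. q (state_event w x))"
    if "finite I" "I \<subseteq> states w" for I
    using that
  proof (induction I rule: finite_induct)
    case empty
    show ?case using add[of "{}" "{}"] by simp
  next
    case (insert x I)
    \<comment> \<open>Tuples are extensional, so two of them realised by the same path
      coincide.\<close>
    have "x = y" if "\<omega> \<in> state_event w x" "\<omega> \<in> state_event w y" "y \<in> I" for \<omega> y
      using that insert.prems
      by (intro PiE_ext[of x w "\<lambda>_. UNIV" y]) (auto simp: state_event_def states_def)
    then have "state_event w x \<inter> (\<Union>x\<in>I. state_event w x) = {}"
      using insert.hyps by blast
    then have "q (state_event w x \<union> (\<Union>x\<in>I. state_event w x)) =
        q (state_event w x) + q (\<Union>x\<in>I. state_event w x)"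
      by (intro add UN_least state_event_subset)
    then show ?case using insert by simp
  qed
  have "state_event u z = (\<Union>x\<in>{x \<in> states w. \<forall>t\<in>u. x t = z t}. state_event w x)" (is "?L = ?R")
  proof
    show "?L \<subseteq> ?R"
    proof
      fix \<omega> assume "\<omega> \<in> ?L"
      then show "\<omega> \<in> ?R"
        using u by (intro UN_I[of "restrict \<omega> w"]) (auto simp: state_event_def)
    qed
    show "?R \<subseteq> ?L" using u by (auto simp: state_event_def)
  qed
  then have "q (state_event u z) = (\<Sum>x\<in>{x \<in> states w. \<forall>t\<in>u. x t = z t}. q (state_event w x))"
    using w by (simp add: sum)
  moreover have "finite u" "u \<subseteq> {0..}" using w u finite_subset by auto
  ultimately show ?thesis by (simp only: uncond[OF \<open>finite u\<close>] uncond[OF w])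
qed

lemma process_total:
  fixes P :: "'x::finite process"
  assumes "stochastic_process P" "finite w" "w \<subseteq> {0..}"
  shows "(\<Sum>x\<in>states w. uncond P (state_event w x)) = 1"
proof -
  have "uncond P (state_event {} undefined) = 1"
    using stochastic_process_additive[OF assms(1)] by (auto simp: state_event_def)
  then show ?thesis
    using process_marginal[OF assms, of "{}" undefined] by simp
qed

text \<open>Tuples on \<open>w\<close> are grouped by their restriction to \<open>u\<close>; the
  group sums are the marginals.\<close>

lemma expect_restrict:
  fixes P :: "'x::finite process"
  assumes "stochastic_process P" "finite w" "w \<subseteq> {0..}" "u \<subseteq> w"
  shows "expect P w (\<lambda>x. h (restrict x u)) = expect P u h"
proof -
  have eq: "(\<forall>t\<in>u. x t = z t) \<longleftrightarrow> restrict x u = z" if "z \<in> states u" for x z :: "real \<Rightarrow> 'x"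
    using that by (force simp: states_def PiE_def extensional_def restrict_def fun_eq_iff)
  have "expect P u h = (\<Sum>z\<in>states u. \<Sum>x\<in>{x \<in> states w. restrict x u = z}.
      h (restrict x u) * uncond P (state_event w x))"
    by (simp add: expect_def process_marginal[OF assms] eq sum_distrib_left)
  also have "\<dots> = expect P w (\<lambda>x. h (restrict x u))"
    unfolding expect_def using assms(2) finite_subset[OF assms(4)] by (intro sum.group) auto
  finally show ?thesis by simp
qed

text \<open>Each tuple has probability at most 1. The crude bound does not depend on
  \<open>P\<close>, so infima over the chain are bounded below.\<close>

lemma abs_expect_le:
  fixes P :: "'x::finite process"
  assumes "stochastic_process P" "finite w" "w \<subseteq> {0..}"
  shows "\<bar>expect P w h\<bar> \<le> (\<Sum>x\<in>states w. \<bar>h x\<bar>)"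
proof -
  have "\<bar>h x * uncond P (state_event w x)\<bar> \<le> \<bar>h x\<bar>" if "x \<in> states w" for x
  proof -
    have "uncond P (state_event w x) \<le> 1"
      unfolding process_total[OF assms, symmetric]
      using that assms by (intro member_le_sum) (auto intro: process_state_event_nonneg)
    then show ?thesis
      using process_state_event_nonneg[OF assms] by (simp add: abs_mult mult_left_le)
  qed
  then show ?thesis
    unfolding expect_def by (intro order_trans[OF sum_abs sum_mono])
qed

lemma lower_expect_le:
  assumes "P \<in> ictmc \<Q> \<M>" "finite w" "w \<subseteq> {0..}"
  shows "lower_expect \<Q> \<M> w h \<le> expect P w h"
  unfolding lower_expect_def
proof (rule cINF_lower[OF _ assms(1)])
  have "- (\<Sum>x\<in>states w. \<bar>h x\<bar>) \<le> expect P w h" if "P \<in> ictmc \<Q> \<M>" for P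
    using abs_expect_le[of P w h] that assms(2,3) by (auto simp: ictmc_def)
  then show "bdd_below ((\<lambda>P. expect P w h) ` ictmc \<Q> \<M>)"
    by (auto simp: bdd_below_def)
qed

section \<open>Augmented processes and output events\<close>

lemma prob_Y_augment:
  fixes P :: "'x process"
  shows "prob_Y (augment K P) u B = expect P u (output_prob K u B)"
proof -
  have "state_event u xu \<inter> state_event {} xw = state_event u xu" for xu xw :: "real \<Rightarrow> 'x"
    by (auto simp: state_event_def)
  then show ?thesis by (simp add: prob_Y_def augment_def expect_def)
qed

text \<open>Two tuples that agree on the overlap of \<open>u\<close> and \<open>v\<close> glue to a
  tuple on the union, and restriction undoes the glueing. The double sum thus becomes one
  expectation under \<open>P\<close>.\<close>

lemma cond_expect_augment:
  fixes K :: "'x::finite \<Rightarrow> 'y set \<Rightarrow> real"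
  assumes "finite u" "finite v"
  shows "cond_expect (augment K P) v f u B =
    expect P (u \<union> v) (\<lambda>x. output_prob K u B (restrict x u) * f (restrict x v)) /
    expect P u (output_prob K u B)"
proof -
  define S where "S xv = {xu \<in> states u. \<forall>t\<in>u \<inter> v. xu t = xv t}" for xv :: "real \<Rightarrow> 'x"
  define g where "g xv xu = f xv * (output_prob K u B xu *
      uncond P (state_event u xu \<inter> state_event (v - u) (restrict xv (v - u))))" for xv xu
  have "(\<Sum>xv\<in>states v. f xv * prob_XY (augment K P) v xv u B) = (\<Sum>xv\<in>states v. \<Sum>xu\<in>S xv. g xv xu)"
    by (simp add: prob_XY_def augment_def S_def g_def sum_distrib_left)
  also have "\<dots> = (\<Sum>(xv, xu)\<in>Sigma (states v) S. g xv xu)"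
    using assms by (intro sum.Sigma) (auto simp: S_def)
  also have "\<dots> = expect P (u \<union> v) (\<lambda>x. output_prob K u B (restrict x u) * f (restrict x v))"
    unfolding expect_def
  proof (rule sum.reindex_bij_witness[where j="\<lambda>(xv, xu) t. if t \<in> u then xu t else xv t"
        and i="\<lambda>x. (restrict x v, restrict x u)"], goal_cases)
    case (1 a)
    then show ?case
      by (auto simp: S_def states_def PiE_def extensional_def restrict_def fun_eq_iff)
  next
    case (2 a)
    then show ?case by (auto simp: S_def states_def PiE_def extensional_def)
  next
    case (3 x)
    then show ?case
      by (auto simp: states_def PiE_def extensional_def restrict_def fun_eq_iff)
  next
    case (4 x)
    then show ?case by (auto simp: S_def)
  next
    case (5 a)
    obtain xv xu where a: "a = (xv, xu)" by force
    define x where "x = (\<lambda>t. if t \<in> u then xu t else xv t)"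
    have "state_event u xu \<inter> state_event (v - u) (restrict xv (v - u)) = state_event (u \<union> v) x"
      by (auto simp: state_event_def x_def)
    moreover have "restrict x u = xu" "restrict x v = xv"
      using 5 unfolding a x_def
      by (auto simp: S_def states_def PiE_def extensional_def restrict_def fun_eq_iff)
    ultimately show ?case by (simp add: a g_def flip: x_def)
  qed
  finally show ?thesis
    by (simp add: cond_expect_def prob_Y_augment sum_divide_distrib[symmetric])
qed

text \<open>Inclusion of a non-empty product passes to the factors, where finite additivity and
  non-negativity give monotonicity. An empty product lies in every product and says nothing about
  its factors.\<close>

lemma output_prob_antimono:
  assumes "output_model Y \<S> K" and "\<forall>t\<in>u. A t \<in> \<S>" "\<forall>t\<in>u. B t \<in> \<S>"
    and "Pi\<^sub>E u A \<subseteq> Pi\<^sub>E u B" "Pi\<^sub>E u A \<noteq> {}"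
  shows "output_prob K u A x \<le> output_prob K u B x"
  unfolding output_prob_def
proof (rule prod_mono)
  fix t assume t: "t \<in> u"
  interpret algebra Y \<S> using assms(1) by (simp add: output_model_def)
  have K: "0 \<le> K z C" if "C \<in> \<S>" for z C
    using assms(1) that by (simp add: output_model_def)
  have add: "additive \<S> (K z)" for z
    using assms(1) by (simp add: output_model_def)
  have "A t \<subseteq> B t"
    using assms(4,5) t by (metis PiE_eq_empty_iff subset_PiE)
  then have "B t = A t \<union> (B t - A t)" by auto
  moreover have "B t - A t \<in> \<S>" using assms(2,3) t by auto
  ultimately have "K (x t) (B t) = K (x t) (A t) + K (x t) (B t - A t)"
    using additiveD[OF add, of "A t" "B t - A t"] assms(2) t by (metis Diff_disjoint)
  then show "0 \<le> K (x t) (A t) \<and> K (x t) (A t) \<le> K (x t) (B t)"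
    using K assms(2,3) t \<open>B t - A t \<in> \<S>\<close> by fastforce
qed

section \<open>The updated lower expectation\<close>

theorem proposition8:
  fixes \<Q> :: "(real^'x^'x) set" and \<M> :: "'x::finite pmf set"
    and Y :: "'y set" and \<S> :: "'y set set" and K :: "'x \<Rightarrow> 'y set \<Rightarrow> real"
    and u v :: "real set" and y :: "real \<Rightarrow> 'y" and f :: "(real \<Rightarrow> 'x) \<Rightarrow> real"
    and B :: "nat \<Rightarrow> real \<Rightarrow> 'y set" and l :: "nat \<Rightarrow> real" and \<phi> :: "(real \<Rightarrow> 'x) \<Rightarrow> real"
  assumes "\<M> \<noteq> {}"
    and "\<Q> \<noteq> {}" and "\<forall>Q\<in>\<Q>. rate_matrix Q" and "convex \<Q>" and "bounded_rates \<Q>"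
    and "separately_specified_rows \<Q>"
    and "output_model Y \<S> K"
    and "u \<in> time_sets" and "v \<in> time_sets" and "y \<in> u \<rightarrow>\<^sub>E Y"
    and "\<forall>i. \<forall>t\<in>u. B i t \<in> \<S>" and "shrinks_to u B y"
    and "\<forall>i. 0 < l i"
    and "\<forall>x\<in>states u. (\<lambda>i. output_prob K u (B i) x / l i) \<longlonglongrightarrow> \<phi> x"
    and "lower_expect \<Q> \<M> u \<phi> > 0"
  shows "(\<forall>R\<in>icthmc K \<Q> \<M>.
            (\<forall>i. prob_Y R u (B i) > 0) \<and> convergent (\<lambda>i. cond_expect R v f u (B i))) \<and>
         is_maximum (lower_updated_expect (icthmc K \<Q> \<M>) v f u B)
           {\<mu>. lower_expect \<Q> \<M> (u \<union> v)
                 (\<lambda>x. \<phi> (restrict x u) * (f (restrict x v) - \<mu>)) \<ge> 0}"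
proof -
  define w where "w = u \<union> v"
  define d where "d = lower_expect \<Q> \<M> u \<phi>"
  define N where "N P = expect P w (\<lambda>x. \<phi> (restrict x u) * f (restrict x v))" for P
  have u: "finite u" "u \<subseteq> {0..}" and v: "finite v" "v \<subseteq> {0..}"
    using assms by (auto simp: time_sets_def)
  then have w: "finite w" "w \<subseteq> {0..}" "u \<subseteq> w" by (auto simp: w_def)
  have ne: "ictmc \<Q> \<M> \<noteq> {}"
    using assms(1-3) ictmc_nonempty by blast
  have sp: "stochastic_process P" if "P \<in> ictmc \<Q> \<M>" for P
    using that by (simp add: ictmc_def)
  have d: "0 < d" "d \<le> expect P u \<phi>" if "P \<in> ictmc \<Q> \<M>" for P
    using assms(15) lower_expect_le[OF that u] by (simp_all add: d_def)
  have prob_lim: "(\<lambda>i. expect P u (output_prob K u (B i)) / l i) \<longlonglongrightarrow> expect P u \<phi>" for P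
    unfolding expect_def sum_divide_distrib times_divide_eq_left[symmetric]
    using assms(14) by (intro tendsto_intros) auto
  have num_lim: "(\<lambda>i. expect P w (\<lambda>x. output_prob K u (B i) (restrict x u) * f (restrict x v)) / l i)
      \<longlonglongrightarrow> N P" for P
    unfolding expect_def N_def sum_divide_distrib times_divide_eq_left[symmetric]
    using assms(14) by (intro tendsto_intros) auto
  have prob_decr: "expect P u (output_prob K u (B (Suc i))) \<le> expect P u (output_prob K u (B i))"
    if "P \<in> ictmc \<Q> \<M>" for P i
    unfolding expect_def
  proof (intro sum_mono mult_right_mono)
    have "(\<Inter>i. Pi\<^sub>E u (B i)) = {y}" and sub: "Pi\<^sub>E u (B (Suc i)) \<subseteq> Pi\<^sub>E u (B i)"
      using assms(12) by (auto simp: shrinks_to_def)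
    \<comment> \<open>The limit point witnesses that the smaller product is non-empty.\<close>
    then have "y \<in> Pi\<^sub>E u (B (Suc i))" by blast
    with sub show "output_prob K u (B (Suc i)) x \<le> output_prob K u (B i) x" for x
      using assms(7,11) by (intro output_prob_antimono) auto
    show "0 \<le> uncond P (state_event u x)" for x
      by (rule process_state_event_nonneg[OF sp[OF that] u])
  qed
  \<comment> \<open>The scaled probabilities have a positive limit, so some later index has positive
    probability; since the probabilities decrease, this carries back to \<open>i\<close>.\<close>
  have prob_pos: "0 < expect P u (output_prob K u (B i))" if P: "P \<in> ictmc \<Q> \<M>" for P i
  proof -
    have "0 < expect P u \<phi>" using d[OF P] by simp
    then have "eventually (\<lambda>j. 0 < expect P u (output_prob K u (B j)) / l j) sequentially"
      using prob_lim order_tendstoD(1) by blast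
    then obtain j where "i \<le> j" "0 < expect P u (output_prob K u (B j)) / l j"
      unfolding eventually_sequentially by (meson linear order_refl order_trans)
    moreover have "expect P u (output_prob K u (B j)) \<le> expect P u (output_prob K u (B i))"
      using prob_decr[OF P] \<open>i \<le> j\<close> by (rule lift_Suc_antimono_le)
    ultimately show ?thesis
      using assms(13) by (metis less_le_trans zero_less_divide_iff not_less_iff_gr_or_eq)
  qed
  have cond_lim: "(\<lambda>i. cond_expect (augment K P) v f u (B i)) \<longlonglongrightarrow> N P / expect P u \<phi>"
    if P: "P \<in> ictmc \<Q> \<M>" for P
  proof -
    have "(\<lambda>i. (expect P w (\<lambda>x. output_prob K u (B i) (restrict x u) * f (restrict x v)) / l i) /
        (expect P u (output_prob K u (B i)) / l i)) \<longlonglongrightarrow> N P / expect P u \<phi>"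
      using d[OF P] by (intro tendsto_divide num_lim prob_lim) auto
    moreover have "l i \<noteq> 0" for i using assms(13) by (metis less_irrefl)
    ultimately show ?thesis
      by (simp add: cond_expect_augment u v w_def)
  qed
  have updated: "updated_expect (augment K P) v f u B = N P / expect P u \<phi>" if "P \<in> ictmc \<Q> \<M>" for P
    unfolding updated_expect_def using cond_lim[OF that] by (rule limI)
  have bdd: "bdd_below ((\<lambda>P. N P / expect P u \<phi>) ` ictmc \<Q> \<M>)"
  proof (rule bdd_belowI2)
    fix P assume P: "P \<in> ictmc \<Q> \<M>"
    \<comment> \<open>\<open>c\<close> bounds the numerators and \<open>d\<close> bounds the
      denominators from below, both independently of \<open>P\<close>.\<close>
    define c where "c = (\<Sum>x\<in>states w. \<bar>\<phi> (restrict x u) * f (restrict x v)\<bar>)"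
    have "\<bar>N P\<bar> \<le> c"
      unfolding N_def c_def by (rule abs_expect_le[OF sp[OF P] w(1,2)])
    then have "\<bar>N P / expect P u \<phi>\<bar> \<le> c / d"
      using d[OF P] by (simp add: abs_divide) (rule frac_le, auto)
    then show "- ((\<Sum>x\<in>states w. \<bar>\<phi> (restrict x u) * f (restrict x v)\<bar>) / d) \<le> N P / expect P u \<phi>"
      unfolding c_def by linarith
  qed
  have lower: "lower_updated_expect (icthmc K \<Q> \<M>) v f u B = (INF P\<in>ictmc \<Q> \<M>. N P / expect P u \<phi>)"
    unfolding lower_updated_expect_def icthmc_def image_image
    by (rule INF_cong) (simp_all add: updated)
  \<comment> \<open>The expectation of \<phi> is lifted from \<open>u\<close> to \<open>w\<close>,
    so that linearity applies on one index set.\<close>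
  have gain: "expect P w (\<lambda>x. \<phi> (restrict x u) * (f (restrict x v) - \<mu>)) = N P - \<mu> * expect P u \<phi>"
    if "P \<in> ictmc \<Q> \<M>" for P \<mu>
    unfolding expect_restrict[OF sp[OF that] w, of \<phi>, symmetric]
    by (simp add: expect_def N_def sum_distrib_left sum_subtractf[symmetric] algebra_simps)
  \<comment> \<open>The admissible \<mu> form a closed half-line ending at the lower updated
    expectation, which is therefore their maximum.\<close>
  have "0 \<le> lower_expect \<Q> \<M> w (\<lambda>x. \<phi> (restrict x u) * (f (restrict x v) - \<mu>)) \<longleftrightarrow>
      \<mu> \<le> lower_updated_expect (icthmc K \<Q> \<M>) v f u B" for \<mu>
  proof -
    let ?h = "\<lambda>x. \<phi> (restrict x u) * (f (restrict x v) - \<mu>)"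
    have "0 \<le> lower_expect \<Q> \<M> w ?h \<longleftrightarrow> (\<forall>P\<in>ictmc \<Q> \<M>. 0 \<le> expect P w ?h)"
    proof
      assume "0 \<le> lower_expect \<Q> \<M> w ?h"
      then show "\<forall>P\<in>ictmc \<Q> \<M>. 0 \<le> expect P w ?h"
        using lower_expect_le[OF _ w(1,2)] order_trans by blast
    next
      assume "\<forall>P\<in>ictmc \<Q> \<M>. 0 \<le> expect P w ?h"
      then show "0 \<le> lower_expect \<Q> \<M> w ?h"
        unfolding lower_expect_def by (intro cINF_greatest ne) auto
    qed
    also have "\<dots> \<longleftrightarrow> (\<forall>P\<in>ictmc \<Q> \<M>. \<mu> \<le> N P / expect P u \<phi>)"
      using d by (intro ball_cong refl) (force simp: gain pos_le_divide_eq)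
    also have "\<dots> \<longleftrightarrow> \<mu> \<le> lower_updated_expect (icthmc K \<Q> \<M>) v f u B"
      \<comment> \<open>A real infimum is characterised this way for a non-empty family bounded
        below, hence the existence of a process and the uniform bound.\<close>
      unfolding lower by (rule le_cINF_iff[OF ne bdd, symmetric])
    finally show ?thesis .
  qed
  then have "is_maximum (lower_updated_expect (icthmc K \<Q> \<M>) v f u B)
      {\<mu>. lower_expect \<Q> \<M> (u \<union> v) (\<lambda>x. \<phi> (restrict x u) * (f (restrict x v) - \<mu>)) \<ge> 0}"
    by (simp add: is_maximum_def w_def)
  moreover have "\<forall>R\<in>icthmc K \<Q> \<M>.
      (\<forall>i. prob_Y R u (B i) > 0) \<and> convergent (\<lambda>i. cond_expect R v f u (B i))"
    using prob_pos cond_lim by (auto simp: icthmc_def prob_Y_augment intro: convergentI)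
  ultimately show ?thesis by blast
qed

end
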